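(* Let $\mu\neq\delta_0$ be a probability measure supported on $[0,\infty)$ and let $\mu=\mu_{1,k}\boxtimes\mu_{2,k}$, $k\in\mathbb{N}$, be a family of decompositions with $\mu_{1,k},\mu_{2,k}$ probability measures on $[0,\infty)$. Then there exists a sequence $\{\lambda_k\}\subset(0,\infty)$ such that the families $\{\mu_{1,k}\circ D_{\lambda_k}\}_{k\in\mathbb{N}}$ and $\{\mu_{2,k}\circ D_{\lambda_k^{-1}}\}_{k\in\mathbb{N}}$ are tight; moreover $\delta_0$ is not in the weak closure of either of these families. (Note $\mu=(\mu_{1,k}\circ D_{\lambda_k})\boxtimes(\mu_{2,k}\circ D_{\lambda_k^{-1}})$.)
   Context: $\boxtimes$ is free multiplicative convolution of probability measures on $[0,\infty)$. For $\lambda>0$, $\rho\circ D_\lambda$ denotes the dilation of $\rho$ by the factor $\lambda$, i.e. $\rho\boxtimes\delta_c$ for the appropriate $c\in\{\lambda,\lambda^{-1}\}$, chosen consistently so that $D_\lambda$ and $D_{\lambda^{-1}}$ are inverse dilations. *)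

theory Defs
  imports "HOL-Probability.Probability"
begin

definition prob_nonneg :: "real measure \<Rightarrow> bool" where
  "prob_nonneg \<mu> \<longleftrightarrow> real_distribution \<mu> \<and> measure \<mu> {..<0} = 0"

definition delta0 :: "real measure" where
  "delta0 = return borel 0"

definition psi_tr :: "real measure \<Rightarrow> real \<Rightarrow> real" where
  "psi_tr \<mu> x = (\<integral>t. x * t / (1 - x * t) \<partial>\<mu>)"

text \<open>S-transform: S(z) = chi(z) (1+z)/z with chi the inverse of psi restricted to
  the negative half-line (defined for mu({0}) - 1 < z < 0 when mu is not delta0).\<close>
definition S_tr :: "real measure \<Rightarrow> real \<Rightarrow> real" where
  "S_tr \<mu> z = (THE x. x < 0 \<and> psi_tr \<mu> x = z) * (1 + z) / z"

text \<open>Free multiplicative convolution (Bercovici--Voiculescu): the unique probability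
  measure on [0,infinity) whose S-transform is the product of the S-transforms near 0;
  it is delta0 if one factor is delta0.\<close>
definition boxtimes :: "real measure \<Rightarrow> real measure \<Rightarrow> real measure" where
  "boxtimes \<mu> \<nu> =
     (if \<mu> = delta0 \<or> \<nu> = delta0 then delta0
      else (THE \<rho>. prob_nonneg \<rho> \<and> \<rho> \<noteq> delta0 \<and>
              (\<exists>\<epsilon>>0. \<forall>z\<in>{-\<epsilon><..<0}. S_tr \<rho> z = S_tr \<mu> z * S_tr \<nu> z)))"

text \<open>Dilation: (rho o D_lambda)(A) = rho(lambda A), i.e. the push-forward of rho under
  t \<mapsto> t / lambda (equivalently rho boxtimes delta_{1/lambda}).\<close>
definition dil :: "real \<Rightarrow> real measure \<Rightarrow> real measure" where
  "dil c \<rho> = distr \<rho> borel (\<lambda>t. t / c)"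

text \<open>delta0 lies in the weak closure of the family (nu k)_k (weak topology on
  probability measures on R is metrizable, so closure = sequential closure).\<close>
definition delta0_in_weak_closure :: "(nat \<Rightarrow> real measure) \<Rightarrow> bool" where
  "delta0_in_weak_closure \<nu> \<longleftrightarrow> (\<exists>r::nat \<Rightarrow> nat. weak_conv_m (\<lambda>j. \<nu> (r j)) delta0)"

end

theory Submission
  imports Defs "HOL-Computational_Algebra.Fundamental_Theorem_Algebra"
begin

text \<open>
  Put \<open>\<tau>\<^sub>\<rho>(y) = -\<psi>\<^sub>\<rho>(-y) = \<integral> ys/(1+ys) d\<rho>(s)\<close>. In terms of \<open>\<tau>\<close>, the product formula for S-transforms says that
  \<open>\<tau>\<^sub>\<mu>(a) = t = \<tau>\<^sub>\<nu>(b)\<close> implies \<open>\<tau>(ab(1-t)/t) = t\<close> for the free product of \<open>\<mu>\<close> and \<open>\<nu>\<close>. Fix \<open>t\<^sub>0\<close> below the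
  supremum of \<open>\<tau>\<^sub>\<mu>\<close> and dilate the two factors so that the first takes the value \<open>t\<^sub>0\<close> at 1; then the
  second takes the value \<open>t\<^sub>0\<close> at a point c independent of k, so no subsequence tends to \<open>\<delta>\<^sub>0\<close>. For
  \<open>t < t\<^sub>0\<close> monotonicity bounds each factor at level t by its value at level \<open>t\<^sub>0\<close>, hence the
  product formula bounds the other factor from the other side, uniformly in k; this is tightness.

  The definition of the free product by a definite description is empty without an existence proof.
  The product is obtained as a weak limit of finite free multiplicative convolutions: replace \<open>\<mu>\<close> and \<open>\<nu>\<close>
  by the empirical measures of n positive numbers \<open>x\<^sub>i\<close>, \<open>w\<^sub>i\<close>. The polynomial with coefficients
  \<open>e\<^sub>k(x) e\<^sub>k(w) / binomial(n,k)\<close> is \<open>\<Prod>(1 + z\<^sub>i X)\<close> with positive \<open>z\<^sub>i\<close> (Szego, via the Grace-Walsh-Szego theorem).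
  Since the \<open>e\<^sub>k\<close> are log-concave, the ratio \<open>e\<^sub>k/e\<^sub>k\<^sub>+\<^sub>1\<close> at \<open>k \<sim> tn\<close> is asymptotically the point where \<open>\<tau>\<close>
  takes the value t, and these ratios are multiplicative up to the factor \<open>(n-k)/(k+1) \<rightarrow> (1-t)/t\<close>.
\<close>

section \<open>Elementary symmetric polynomials of positive reals\<close>

definition linear_prod :: "'a::comm_ring_1 list \<Rightarrow> 'a poly" where
  "linear_prod xs = prod_list (map (\<lambda>x. [:1, x:]) xs)"

abbreviation esym :: "'a::comm_ring_1 list \<Rightarrow> nat \<Rightarrow> 'a" where
  "esym xs \<equiv> coeff (linear_prod xs)"

lemma linear_prod_Nil [simp]: "linear_prod [] = 1"
  and linear_prod_Cons [simp]: "linear_prod (x # xs) = [:1, x:] * linear_prod xs"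
  by (simp_all add: linear_prod_def)

lemma esym_0 [simp]: "esym xs 0 = 1"
  by (induction xs) auto

lemma esym_Cons_Suc: "esym (x # xs) (Suc k) = esym xs (Suc k) + x * esym xs k"
  by (simp add: algebra_simps)

lemma esym_Cons: "esym (x # xs) k = esym xs k + (if k = 0 then 0 else x * esym xs (k - 1))"
  by (cases k) (simp_all add: esym_Cons_Suc del: linear_prod_Cons)

lemma esym_eq_0: "k > length xs \<Longrightarrow> esym xs k = 0"
  by (induction xs arbitrary: k) (auto simp: esym_Cons simp del: linear_prod_Cons)

lemma degree_linear_prod_le: "degree (linear_prod xs) \<le> length xs"
  by (intro degree_le allI impI esym_eq_0)

lemma poly_linear_prod: "poly (linear_prod xs) z = (\<Sum>k\<le>length xs. esym xs k * z ^ k)"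
  unfolding poly_altdef
  by (intro sum.mono_neutral_left) (use degree_linear_prod_le[of xs] in \<open>auto simp: coeff_eq_0\<close>)

lemma esym_pos:
  fixes xs :: "real list"
  shows "\<forall>x\<in>set xs. x > 0 \<Longrightarrow> k \<le> length xs \<Longrightarrow> esym xs k > 0"
proof (induction xs arbitrary: k)
  case (Cons x xs)
  have "esym xs k \<ge> 0"
    using Cons.IH[of k] Cons.prems(1) esym_eq_0[of xs k] by (cases "k \<le> length xs") auto
  moreover have "k > 0 \<Longrightarrow> esym xs (k - 1) > 0"
    using Cons by auto
  ultimately show ?case
    using Cons.prems by (auto simp: esym_Cons add_nonneg_pos simp del: linear_prod_Cons)
qed auto

lemma esym_nonneg: "\<forall>x\<in>set xs. x > (0::real) \<Longrightarrow> esym xs k \<ge> 0"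
  using esym_pos[of xs k] esym_eq_0[of xs k] by (cases "k \<le> length xs") auto

text \<open>Adjoin x, so that the new coefficients are \<open>e k + x * e (k - 1)\<close>, and
  compare powers of x. The constant and quadratic parts are the induction hypothesis at (j, k) and
  (j - 1, k - 1). In the linear part \<open>e j * e k\<close> cancels, and what remains chains two
  instances through \<open>e j * e k\<close>. Allowing every pair j \<le> k, and not only
  neighbours, makes this induction go through without dividing by coefficients that may
  vanish.\<close>

lemma esym_log_concave:
  fixes xs :: "real list"
  assumes "\<forall>x\<in>set xs. x > 0" "j \<le> k"
  shows "esym xs j * esym xs (Suc k) \<le> esym xs (Suc j) * esym xs k"
  using assms
proof (induction xs arbitrary: j k)
  case (Cons x xs)
  define e where "e = esym xs"
  have IH: "e j * e (Suc k) \<le> e (Suc j) * e k" if "j \<le> k" for j k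
    unfolding e_def using Cons.IH Cons.prems that by auto
  have nn: "e k \<ge> 0" for k
    unfolding e_def using esym_nonneg Cons.prems by auto
  have x: "x > 0"
    using Cons.prems by auto
  have unf: "esym (x # xs) k = e k + (if k = 0 then 0 else x * e (k - 1))" for k
    unfolding e_def by (rule esym_Cons)
  show ?case
  proof (cases k)
    case 0
    then show ?thesis using Cons.prems by simp
  next
    case k: (Suc k')
    show ?thesis
    proof (cases j)
      case 0
      have "e 0 * e (Suc k) \<le> e 1 * e k" "e 0 * e k \<le> e 1 * e k'"
        using IH[of 0 k] IH[of 0 k'] k by auto
      then have "e 0 * e (Suc k) + x * (e 0 * e k) + 0
          \<le> e 1 * e k + x * (e 1 * e k') + (x * (e 0 * e k) + x * x * (e 0 * e k'))"
        using x nn by (intro add_mono mult_left_mono) auto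
      then show ?thesis
        unfolding unf using 0 k by (simp add: algebra_simps)
    next
      case j: (Suc j')
      have 1: "e j * e (Suc k) \<le> e (Suc j) * e k" "e j' * e k \<le> e j * e k'"
        using IH[of j k] IH[of j' k'] k j Cons.prems by auto
      have 2: "e j' * e (Suc k) \<le> e (Suc j) * e k'"
      proof (cases "j = k")
        case False
        have "e j' * e (Suc k) \<le> e j * e k"
          using IH[of j' k] j Cons.prems by auto
        also have "\<dots> \<le> e (Suc j) * e k'"
          using IH[of j k'] j k False Cons.prems by auto
        finally show ?thesis .
      qed (use j k in \<open>simp add: mult.commute\<close>)
      have "e j * e (Suc k) + x * x * (e j' * e k) + x * (e j' * e (Suc k))
          \<le> e (Suc j) * e k + x * x * (e j * e k') + x * (e (Suc j) * e k')"
        using x 1 2 by (intro add_mono mult_left_mono) auto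
      then show ?thesis
        unfolding unf using j k by (simp add: algebra_simps)
    qed
  qed
qed auto

section \<open>Ratios of successive coefficients compared with the transform\<close>

definition list_tau :: "real list \<Rightarrow> real \<Rightarrow> real" where
  "list_tau xs y = (\<Sum>x\<leftarrow>xs. y * x / (1 + y * x))"

text \<open>Both sides are y P'(y) for P the product of the 1 + x X: once from the coefficients,
  once from the logarithmic derivative of the factors. Thus \<open>list_tau xs y\<close>, which is
  the length times \<open>tau\<close> of the empirical measure, is the mean of the distribution on
  indices with weights \<open>esym xs k * y ^ k\<close>.\<close>

lemma esym_mean:
  fixes xs :: "real list"
  assumes "\<forall>x\<in>set xs. x > 0" "y > 0"
  shows "(\<Sum>k\<le>length xs. real k * (esym xs k * y ^ k)) =
         list_tau xs y * (\<Sum>k\<le>length xs. esym xs k * y ^ k)"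
proof -
  have 1: "y * poly (pderiv (linear_prod xs)) y = (\<Sum>k\<le>length xs. real k * (esym xs k * y ^ k))"
  proof -
    have "linear_prod xs = (\<Sum>k\<le>length xs. monom (esym xs k) k)"
    proof (rule poly_eqI)
      fix n show "esym xs n = coeff (\<Sum>k\<le>length xs. monom (esym xs k) k) n"
        using esym_eq_0[of xs n] by (cases "n \<le> length xs") (auto simp: coeff_sum if_distrib cong: if_cong)
    qed
    then have "pderiv (linear_prod xs) = (\<Sum>k\<le>length xs. monom (of_nat k * esym xs k) (k - 1))"
      using higher_pderiv_sum[of 1 "\<lambda>k. monom (esym xs k) k" "{..length xs}"] by (simp add: pderiv_monom)
    then have "y * poly (pderiv (linear_prod xs)) y = (\<Sum>k\<le>length xs. y * (real k * esym xs k * y ^ (k - 1)))"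
      by (simp add: poly_sum poly_monom sum_distrib_left)
    also have "\<dots> = (\<Sum>k\<le>length xs. real k * (esym xs k * y ^ k))"
    proof (rule sum.cong)
      fix k show "y * (real k * esym xs k * y ^ (k - 1)) = real k * (esym xs k * y ^ k)"
        by (cases k) auto
    qed auto
    finally show ?thesis .
  qed
  have "y * poly (pderiv (linear_prod xs)) y = list_tau xs y * poly (linear_prod xs) y"
    using assms(1)
  proof (induction xs)
    case (Cons x xs)
    have pos: "1 + y * x > 0"
      using Cons.prems assms by (auto intro!: add_pos_pos)
    have IH: "y * poly (pderiv (linear_prod xs)) y = list_tau xs y * poly (linear_prod xs) y"
      using Cons by auto
    have "y * poly (pderiv (linear_prod (x # xs))) y =
        (1 + y * x) * (y * poly (pderiv (linear_prod xs)) y) + y * x * poly (linear_prod xs) y"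
      unfolding linear_prod_Cons pderiv_mult by (simp add: pderiv_pCons algebra_simps)
    also have "\<dots> = (1 + y * x) * (list_tau xs y + y * x / (1 + y * x)) * poly (linear_prod xs) y"
      unfolding IH using pos by (simp add: distrib_left) (simp add: algebra_simps)
    also have "\<dots> = list_tau (x # xs) y * poly (linear_prod (x # xs)) y"
      by (simp add: list_tau_def algebra_simps add_divide_distrib)
    finally show ?case .
  qed (auto simp: list_tau_def)
  then show ?thesis
    using 1 by (simp add: poly_linear_prod)
qed

lemma weighted_sum_pos:
  fixes xs :: "real list"
  assumes "\<forall>x\<in>set xs. x > 0" "y > 0"
  shows "(\<Sum>k\<le>length xs. esym xs k * y ^ k) > 0"
  using assms by (intro sum_pos) (auto intro!: mult_pos_pos esym_pos)

text \<open>The left side is the mean of the distribution on \<open>{0..n}\<close> with weights \<open>e\<^sub>j z\<^sup>j\<close>, which by log-concavity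
  decay geometrically beyond k.\<close>
lemma list_tau_le:
  fixes xs :: "real list"
  assumes xs: "\<forall>x\<in>set xs. x > 0" and z: "0 < z" "z < y" and k: "k \<le> length xs"
    and le: "y * esym xs (Suc k) \<le> esym xs k"
  shows "list_tau xs z \<le> real k + z / (y - z)"
proof -
  define n where "n = length xs"
  define a where "a j = esym xs j * z ^ j" for j
  define r where "r = z / y"
  have r: "0 < r" "r < 1" and r': "r / (1 - r) = z / (y - z)"
    using z by (auto simp: r_def field_simps)
  have a0: "a j \<ge> 0" for j
    using esym_nonneg[OF xs] z by (auto simp: a_def)
  have dec: "a (Suc j) \<le> r * a j" if "j \<ge> k" for j
  proof -
    have "esym xs k * (y * esym xs (Suc j)) \<le> y * (esym xs (Suc k) * esym xs j)"
      using esym_log_concave[OF xs that] z by (auto simp: algebra_simps)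
    also have "\<dots> \<le> esym xs k * esym xs j"
      using mult_right_mono[OF le esym_nonneg[OF xs, of j]] by (simp add: algebra_simps)
    finally have "y * esym xs (Suc j) \<le> esym xs j"
      using esym_pos[OF xs k] by (simp add: mult_le_cancel_left_pos)
    then have "y * esym xs (Suc j) * z ^ Suc j \<le> esym xs j * z ^ Suc j"
      using z by (intro mult_right_mono) auto
    then show ?thesis
      using z by (simp add: a_def r_def field_simps)
  qed
  \<comment> \<open>Truncated subtraction makes B / W the expected excess of the index over k.
    Shifting the index by one and using \<open>dec\<close> gives B \<le> r (B + W), which is solved
    for B.\<close>
  define B where "B = (\<Sum>j\<le>n. real (j - k) * a j)"
  define W where "W = (\<Sum>j\<le>n. a j)"
  have W: "W > 0"
    unfolding W_def a_def n_def using weighted_sum_pos[OF xs] z by auto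
  have an: "a j = 0" if "j > n" for j
    using esym_eq_0 that by (auto simp: a_def n_def)
  have "B = (\<Sum>j\<le>Suc n. real (j - k) * a j)"
    by (simp add: B_def an)
  also have "\<dots> = (\<Sum>j\<le>n. real (Suc j - k) * a (Suc j))"
    by (subst sum.atMost_Suc_shift) auto
  also have "\<dots> \<le> (\<Sum>j\<le>n. r * (real (j - k) * a j + a j))"
  proof (rule sum_mono)
    fix j
    show "real (Suc j - k) * a (Suc j) \<le> r * (real (j - k) * a j + a j)"
    proof (cases "j \<ge> k")
      case True
      have "real (Suc j - k) * a (Suc j) \<le> real (Suc j - k) * (r * a j)"
        using dec[OF True] by (intro mult_left_mono) auto
      then show ?thesis using True by (simp add: Suc_diff_le algebra_simps)
    next
      case False
      then have "Suc j - k = 0" by simp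
      then show ?thesis using r a0[of j] by simp
    qed
  qed
  also have "\<dots> = r * (B + W)"
    by (simp add: B_def W_def sum_distrib_left sum.distrib distrib_left)
  finally have B: "B \<le> r / (1 - r) * W"
    using r by (simp add: field_simps)
  have "list_tau xs z * W = (\<Sum>j\<le>n. real j * a j)"
    using esym_mean[OF xs z(1)] by (simp add: W_def a_def n_def)
  also have "\<dots> \<le> (\<Sum>j\<le>n. real k * a j + real (j - k) * a j)"
    using a0 by (intro sum_mono) (auto simp flip: distrib_right intro!: mult_right_mono)
  also have "\<dots> = real k * W + B"
    by (simp add: sum.distrib W_def B_def sum_distrib_left)
  also have "\<dots> \<le> (real k + r / (1 - r)) * W"
    using B by (simp add: algebra_simps)
  finally show ?thesis
    using W r' by (simp add: mult_le_cancel_right_pos)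
qed

text \<open>Mirror image of \<open>list_tau_le\<close>: up to index k + 1 the weights grow at least
  by the factor z / y per step, so the expected shortfall below k + 1 is at most the geometric sum r
  / (1 - r) = y / (z - y). Since k is below the length, \<open>esym xs (Suc k)\<close> is positive
  and can be cancelled.\<close>

lemma list_tau_ge:
  fixes xs :: "real list"
  assumes xs: "\<forall>x\<in>set xs. x > 0" and y: "0 < y" "y < z" and k: "k < length xs"
    and le: "esym xs k \<le> y * esym xs (Suc k)"
  shows "list_tau xs z \<ge> real k + 1 - y / (z - y)"
proof -
  define n where "n = length xs"
  define a where "a j = esym xs j * z ^ j" for j
  define r where "r = y / z"
  have r: "0 < r" "r < 1" and r': "r / (1 - r) = y / (z - y)"
    using y by (auto simp: r_def field_simps)
  have a0: "a j \<ge> 0" for j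
    using esym_nonneg[OF xs] y by (auto simp: a_def)
  have inc: "a j \<le> r * a (Suc j)" if "j \<le> k" for j
  proof -
    have "esym xs j * esym xs (Suc k) \<le> esym xs (Suc j) * esym xs k"
      by (rule esym_log_concave[OF xs that])
    also have "\<dots> \<le> esym xs (Suc j) * (y * esym xs (Suc k))"
      using le esym_nonneg[OF xs] by (intro mult_left_mono) auto
    finally have "esym xs j * esym xs (Suc k) \<le> y * esym xs (Suc j) * esym xs (Suc k)"
      by (simp add: algebra_simps)
    then have "esym xs j \<le> y * esym xs (Suc j)"
      using esym_pos[OF xs, of "Suc k"] k by (simp add: mult_le_cancel_right_pos)
    then have "esym xs j * z ^ Suc j \<le> y * esym xs (Suc j) * z ^ Suc j"
      using y by (intro mult_right_mono) auto
    then show ?thesis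
      using y by (simp add: a_def r_def field_simps)
  qed
  define B where "B = (\<Sum>j\<le>n. real (Suc k - j) * a j)"
  define W where "W = (\<Sum>j\<le>n. a j)"
  have W: "W > 0"
    unfolding W_def a_def n_def using weighted_sum_pos[OF xs] y by auto
  have an: "a j = 0" if "j > n" for j
    using esym_eq_0 that by (auto simp: a_def n_def)
  have "B \<le> (\<Sum>j\<le>n. r * (real (Suc k - j) * a (Suc j)))"
    unfolding B_def
  proof (rule sum_mono)
    fix j
    show "real (Suc k - j) * a j \<le> r * (real (Suc k - j) * a (Suc j))"
    proof (cases "j \<le> k")
      case True
      have "real (Suc k - j) * a j \<le> real (Suc k - j) * (r * a (Suc j))"
        using inc[OF True] by (intro mult_left_mono) auto
      then show ?thesis by (simp add: algebra_simps)
    qed auto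
  qed
  \<comment> \<open>The nonnegative term of index 0 is added so that the shifted sum becomes a full
    sum again, with k + 2 in place of k + 1; lowering this back to k + 1 costs at most W.\<close>
  also have "\<dots> \<le> r * (real (Suc (Suc k) - 0) * a 0 + (\<Sum>j\<le>n. real (Suc (Suc k) - Suc j) * a (Suc j)))"
    unfolding sum_distrib_left[symmetric] using a0[of 0] r by (intro mult_left_mono) auto
  also have "\<dots> = r * (\<Sum>j\<le>Suc n. real (Suc (Suc k) - j) * a j)"
    by (subst sum.atMost_Suc_shift) auto
  also have "\<dots> = r * (\<Sum>j\<le>n. real (Suc (Suc k) - j) * a j)"
    by (simp add: an)
  also have "\<dots> \<le> r * (\<Sum>j\<le>n. real (Suc k - j) * a j + a j)"
  proof (intro mult_left_mono sum_mono)
    fix j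
    have "real (Suc (Suc k) - j) * a j \<le> (real (Suc k - j) + 1) * a j"
      using a0 by (intro mult_right_mono) auto
    then show "real (Suc (Suc k) - j) * a j \<le> real (Suc k - j) * a j + a j"
      by (simp add: distrib_right)
  qed (use r in auto)
  also have "\<dots> = r * (B + W)"
    by (simp add: B_def W_def sum.distrib)
  finally have B: "B \<le> r / (1 - r) * W"
    using r by (simp add: field_simps)
  have "(real (Suc k) - r / (1 - r)) * W \<le> real (Suc k) * W - B"
    using B by (simp add: algebra_simps)
  also have "\<dots> = (\<Sum>j\<le>n. real (Suc k) * a j - real (Suc k - j) * a j)"
    by (simp add: sum_subtractf W_def B_def sum_distrib_left)
  also have "\<dots> \<le> (\<Sum>j\<le>n. real j * a j)"
    using a0 by (intro sum_mono) (auto simp flip: left_diff_distrib intro!: mult_right_mono)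
  also have "\<dots> = list_tau xs z * W"
    using esym_mean[OF xs, of z] y by (simp add: W_def a_def n_def)
  finally show ?thesis
    using W r' by (simp add: mult_le_cancel_right_pos)
qed

section \<open>Finite free multiplicative convolution\<close>

text \<open>The binomial factors are split off because n copies of z have elementary symmetric
  functions \<open>of_nat (n choose k) * z ^ k\<close>. Hence the symmetric multi-affine form with
  coefficients \<open>b k\<close> restricts to this polynomial on the diagonal.\<close>

definition binom_poly :: "nat \<Rightarrow> (nat \<Rightarrow> complex) \<Rightarrow> complex poly" where
  "binom_poly n b = (\<Sum>k\<le>n. monom (of_nat (n choose k) * b k) k)"

lemma coeff_binom_poly: "coeff (binom_poly n b) k = of_nat (n choose k) * b k"
  by (auto simp: binom_poly_def coeff_sum if_distrib cong: if_cong)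

lemma degree_binom_poly_le: "degree (binom_poly n b) \<le> n"
  by (intro degree_le) (auto simp: coeff_binom_poly)

text \<open>The left side is the polar derivative with pole \<zeta>. It corresponds to fixing one of
  the n + 1 variables of the symmetric form at \<zeta>, which leaves a form in n variables with
  coefficients \<open>b k + \<zeta> * b (Suc k)\<close>.\<close>

lemma polar_binom_poly:
  "smult (of_nat (Suc n)) (binom_poly (Suc n) b) + [:\<zeta>, -1:] * pderiv (binom_poly (Suc n) b)
   = smult (of_nat (Suc n)) (binom_poly n (\<lambda>k. b k + \<zeta> * b (Suc k)))"
proof (rule poly_eqI)
  fix k
  have 1: "of_nat (Suc k) * of_nat (Suc n choose Suc k) = (of_nat (Suc n) * of_nat (n choose k) :: complex)"
    by (metis Suc_times_binomial_eq of_nat_mult mult.commute)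
  have 2: "(of_nat (Suc n) - of_nat k) * of_nat (Suc n choose k) = (of_nat (Suc n) * of_nat (n choose k) :: complex)"
  proof (cases "k \<le> n")
    case True
    have "(Suc n - k) * (Suc n choose k) = Suc n * (n choose k)"
      using binomial_absorb_comp[of "Suc n" k] by simp
    then have "of_nat (Suc n - k) * of_nat (Suc n choose k) = (of_nat (Suc n) * of_nat (n choose k) :: complex)"
      by (metis of_nat_mult)
    then show ?thesis
      using True by (subst (asm) of_nat_diff) auto
  next
    case False
    then show ?thesis
      by (cases "k = Suc n") (auto simp: binomial_eq_0)
  qed
  have "coeff ([:\<zeta>, -1:] * pderiv (binom_poly (Suc n) b)) k =
     \<zeta> * (of_nat (Suc k) * of_nat (Suc n choose Suc k) * b (Suc k)) - of_nat k * of_nat (Suc n choose k) * b k"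
    by (cases k) (simp_all add: coeff_pderiv coeff_binom_poly mult.assoc)
  then have "coeff (smult (of_nat (Suc n)) (binom_poly (Suc n) b) + [:\<zeta>, -1:] * pderiv (binom_poly (Suc n) b)) k
    = (of_nat (Suc n) - of_nat k) * of_nat (Suc n choose k) * b k + \<zeta> * (of_nat (Suc k) * of_nat (Suc n choose Suc k) * b (Suc k))"
    unfolding coeff_add coeff_smult coeff_binom_poly by (simp add: algebra_simps)
  also have "\<dots> = coeff (smult (of_nat (Suc n)) (binom_poly n (\<lambda>k. b k + \<zeta> * b (Suc k)))) k"
    unfolding 1 2 coeff_smult coeff_binom_poly by (simp add: algebra_simps)
  finally show "coeff (smult (of_nat (Suc n)) (binom_poly (Suc n) b) + [:\<zeta>, -1:] * pderiv (binom_poly (Suc n) b)) k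
    = coeff (smult (of_nat (Suc n)) (binom_poly n (\<lambda>k. b k + \<zeta> * b (Suc k)))) k" .
qed

lemma complex_poly_root_list:
  fixes f :: "complex poly"
  assumes "f \<noteq> 0"
  obtains rs where "length rs = degree f" "f = smult (lead_coeff f) (\<Prod>r\<leftarrow>rs. [:-r, 1:])"
proof -
  obtain M where M: "size M = degree f" "f = smult (lead_coeff f) (\<Prod>x\<in>#M. [:-x, 1:])"
    using alg_closed_imp_factorization[OF assms] by blast
  obtain rs where "mset rs = M"
    using ex_mset by blast
  with M that[of rs] show ?thesis
    by (metis mset_map prod_mset_prod_list size_mset)
qed

lemma poly_pderiv_root_list:
  fixes z :: "'a::field"
  assumes "z \<notin> set rs"
  shows "poly (pderiv (\<Prod>r\<leftarrow>rs. [:-r, 1:])) z = poly (\<Prod>r\<leftarrow>rs. [:-r, 1:]) z * (\<Sum>r\<leftarrow>rs. 1 / (z - r))"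
  using assms
proof (induction rs)
  case (Cons r rs)
  then show ?case
    unfolding prod_list.Cons list.map pderiv_mult by (simp add: pderiv_pCons field_simps)
qed auto

lemma poly_root_list_eq_0_iff:
  fixes z :: "'a::field"
  shows "poly (\<Prod>r\<leftarrow>rs. [:-r, 1:]) z = 0 \<longleftrightarrow> z \<in> set rs"
  by (induction rs) auto

text \<open>The inverse of the upper half-plane Im z > h is the disc - Im u > h |u|^2, and the centre of mass
  of points of a disc stays in the disc.\<close>
lemma laguerre:
  fixes f :: "complex poly"
  assumes f: "\<And>z. Im z > 0 \<Longrightarrow> poly f z \<noteq> 0" and deg: "degree f \<le> n" and n: "n > 0"
    and \<zeta>: "Im \<zeta> > 0" and z: "Im z > 0"
  shows "poly (smult (of_nat n) f + [:\<zeta>, -1:] * pderiv f) z \<noteq> 0"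
proof
  assume zero: "poly (smult (of_nat n) f + [:\<zeta>, -1:] * pderiv f) z = 0"
  have f0: "f \<noteq> 0"
    using f[OF z] by auto
  obtain rs where rs: "length rs = degree f" "f = smult (lead_coeff f) (\<Prod>r\<leftarrow>rs. [:-r, 1:])"
    using complex_poly_root_list[OF f0] .
  have root: "Im r \<le> 0" if "r \<in> set rs" for r
  proof (rule ccontr)
    assume "\<not> Im r \<le> 0"
    then have "poly f r \<noteq> 0"
      using f by auto
    then show False
      using that poly_root_list_eq_0_iff[of rs r] by (subst (asm) rs(2)) auto
  qed
  define u where "u i = 1 / (z - rs ! i)" for i
  define m where "m = length rs"
  define S where "S = (\<Sum>i<m. u i)"
  have "z \<notin> set rs"
    using root z by force
  then have "poly (pderiv f) z = poly f z * (\<Sum>r\<leftarrow>rs. 1 / (z - r))"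
    by (subst (1 2) rs(2)) (simp add: pderiv_smult poly_pderiv_root_list del: One_nat_def)
  also have "(\<Sum>r\<leftarrow>rs. 1 / (z - r)) = S"
    by (simp add: S_def u_def m_def sum_list_sum_nth atLeast0LessThan)
  finally have "poly f z * (of_nat n + (\<zeta> - z) * S) = 0"
    using zero by (simp add: algebra_simps)
  then have eq: "of_nat n + (\<zeta> - z) * S = 0"
    using f[OF z] by simp
  then have S0: "S \<noteq> 0"
    using n by auto
  have each: "Im z * (cmod (u i))\<^sup>2 \<le> - Im (u i)" if "i < m" for i
  proof -
    have r: "Im (rs ! i) \<le> 0"
      using that root m_def by auto
    have ne: "z - rs ! i \<noteq> 0"
      using r z by auto
    have "- Im (u i) = Im (z - rs ! i) / (cmod (z - rs ! i))\<^sup>2"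
      unfolding u_def by (simp add: Im_divide cmod_power2 flip: minus_divide_left) (simp add: minus_divide_left)
    moreover have "(cmod (u i))\<^sup>2 = 1 / (cmod (z - rs ! i))\<^sup>2"
      by (simp add: u_def norm_divide power_divide)
    ultimately show ?thesis
      using r ne by (simp add: divide_right_mono)
  qed
  have "(cmod S)\<^sup>2 \<le> (\<Sum>i<m. cmod (u i))\<^sup>2"
    unfolding S_def by (intro power_mono norm_sum) auto
  also have "\<dots> \<le> (\<Sum>i<m. (cmod (u i))\<^sup>2) * m"
    using sum_squared_le_sum_of_squares[of "\<lambda>i. cmod (u i)" "{..<m}"] by simp
  \<comment> \<open>If the degree is below n, the missing roots count as points at infinity, where u
    vanishes; so m may be raised to n.\<close>
  also have "\<dots> \<le> (\<Sum>i<m. (cmod (u i))\<^sup>2) * n"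
    using deg rs(1) by (intro mult_left_mono sum_nonneg) (auto simp: m_def)
  finally have "Im z * (cmod S)\<^sup>2 \<le> Im z * ((\<Sum>i<m. (cmod (u i))\<^sup>2) * n)"
    using z by (intro mult_left_mono) auto
  also have "\<dots> = n * (\<Sum>i<m. Im z * (cmod (u i))\<^sup>2)"
    by (simp add: sum_distrib_left algebra_simps)
  also have "\<dots> \<le> n * (\<Sum>i<m. - Im (u i))"
    using each by (intro mult_left_mono sum_mono) auto
  also have "\<dots> = - (n * Im S)"
    by (simp add: S_def sum_negf)
  finally have 1: "Im z * (cmod S)\<^sup>2 \<le> - (n * Im S)" .
  \<comment> \<open>Multiplying \<open>eq\<close> by the conjugate of S expresses Im S through Im z
    - Im \<zeta>. In the comparison with \<open>1\<close> the terms in Im z cancel, which leaves Im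
    \<zeta> |S|^2 \<le> 0.\<close>
  have "of_nat n * cnj S = (z - \<zeta>) * (S * cnj S)"
    using eq by (metis (no_types, lifting) add_eq_0_iff2 minus_diff_eq minus_mult_left mult.assoc)
  then have "of_nat n * cnj S = (z - \<zeta>) * of_real ((cmod S)\<^sup>2)"
    by (metis complex_norm_square)
  then have "Im (of_nat n * cnj S) = Im ((z - \<zeta>) * of_real ((cmod S)\<^sup>2))"
    by simp
  then have "- (n * Im S) = (Im z - Im \<zeta>) * (cmod S)\<^sup>2"
    by (simp flip: of_real_power)
  with 1 have "Im \<zeta> * (cmod S)\<^sup>2 \<le> 0"
    by (simp add: algebra_simps)
  then show False
    using \<zeta> S0 by (simp add: mult_le_0_iff)
qed

text \<open>Induction on the number of variables: fixing one of them at \<zeta> replaces the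
  polynomial by its polar derivative, which by \<open>laguerre\<close> again has no zero in the
  upper half-plane, and the value of the symmetric form does not change.\<close>

theorem grace_walsh_szego_half_plane:
  assumes "\<And>z. Im z > 0 \<Longrightarrow> poly (binom_poly n b) z \<noteq> 0"
    and "length \<zeta>s = n" and "\<forall>\<zeta>\<in>set \<zeta>s. Im \<zeta> > 0"
  shows "(\<Sum>k\<le>n. esym \<zeta>s k * b k) \<noteq> 0"
  using assms
proof (induction n arbitrary: b \<zeta>s)
  case 0
  then show ?case
    using "0.prems"(1)[of \<i>] by (simp add: binom_poly_def monom_0)
next
  case (Suc n)
  obtain \<zeta> \<zeta>s' where \<zeta>s: "\<zeta>s = \<zeta> # \<zeta>s'" "length \<zeta>s' = n"
    using Suc.prems(2) by (cases \<zeta>s) auto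
  define b' where "b' k = b k + \<zeta> * b (Suc k)" for k
  have "(\<Sum>k\<le>n. esym \<zeta>s' k * b' k) \<noteq> 0"
  proof (rule Suc.IH)
    fix z :: complex assume z: "Im z > 0"
    have "poly (smult (of_nat (Suc n)) (binom_poly (Suc n) b) + [:\<zeta>, -1:] * pderiv (binom_poly (Suc n) b)) z \<noteq> 0"
      using Suc.prems \<zeta>s z by (intro laguerre degree_binom_poly_le) auto
    then show "poly (binom_poly n b') z \<noteq> 0"
      unfolding polar_binom_poly b'_def by simp
  qed (use \<zeta>s Suc.prems in auto)
  moreover have "(\<Sum>k\<le>Suc n. esym \<zeta>s k * b k) = (\<Sum>k\<le>n. esym \<zeta>s' k * b' k)"
  proof -
    have 0: "esym \<zeta>s' (Suc n) = 0"
      using \<zeta>s(2) by (intro esym_eq_0) auto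
    have "(\<Sum>k\<le>Suc n. esym \<zeta>s k * b k) =
       (\<Sum>k\<le>Suc n. esym \<zeta>s' k * b k + (if k = 0 then 0 else \<zeta> * esym \<zeta>s' (k - 1)) * b k)"
      by (simp only: \<zeta>s(1) esym_Cons distrib_right)
    also have "\<dots> = (\<Sum>k\<le>n. esym \<zeta>s' k * b k) + (\<Sum>k\<le>Suc n. (if k = 0 then 0 else \<zeta> * esym \<zeta>s' (k - 1)) * b k)"
      by (simp add: sum.distrib 0 del: sum.atMost_Suc) (simp add: 0)
    also have "(\<Sum>k\<le>Suc n. (if k = 0 then 0 else \<zeta> * esym \<zeta>s' (k - 1)) * b k) = (\<Sum>k\<le>n. \<zeta> * esym \<zeta>s' k * b (Suc k))"
      by (subst sum.atMost_Suc_shift) simp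
    finally show ?thesis
      by (simp add: b'_def sum.distrib algebra_simps)
  qed
  ultimately show ?case
    by simp
qed

section \<open>Real-rootedness of the composed polynomial\<close>

lemma esym_of_real: "esym (map (\<lambda>x. complex_of_real x * c) xs) k = of_real (esym xs k) * c ^ k"
proof (induction xs arbitrary: k)
  case (Cons x xs)
  then show ?case
    by (cases k) (simp_all add: esym_Cons_Suc algebra_simps del: linear_prod_Cons)
qed auto

lemma linear_prod_exists:
  fixes p :: "complex poly"
  assumes "coeff p 0 = 1" and "\<And>z. poly p z = 0 \<Longrightarrow> \<exists>r<0. z = complex_of_real r"
  shows "\<exists>zs. length zs = degree p \<and> (\<forall>z\<in>set zs. z > 0) \<and> p = linear_prod (map complex_of_real zs)"
  using assms
proof (induction "degree p" arbitrary: p)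
  case 0
  then obtain c where "p = [:c:]"
    by (metis degree_eq_zeroE)
  with 0 show ?case
    by (intro exI[of _ "[]"]) (auto simp: one_pCons)
next
  case (Suc n)
  have "\<not> constant (poly p)"
    using Suc.hyps(2) by (simp add: constant_degree)
  then obtain z where z: "poly p z = 0"
    using fundamental_theorem_of_algebra by blast
  then obtain r where r: "r < 0" "z = complex_of_real r"
    using Suc.prems by blast
  obtain q where q: "p = [:-z, 1:] * q"
    using z by (auto simp: poly_eq_0_iff_dvd)
  \<comment> \<open>Since 1 - X / z = (-1 / z) (X - z), the scalar -z moves to the cofactor; p and
    q' then both have constant coefficient 1, as the induction hypothesis wants.\<close>
  define q' where "q' = smult (-z) q"
  have p: "p = [:1, complex_of_real (- 1 / r):] * q'"
  proof -
    have "[:1, complex_of_real (- 1 / r):] = smult (- 1 / z) [:-z, 1:]"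
      using r by simp
    then have "[:1, complex_of_real (- 1 / r):] * q' = smult (- 1 / z * - z) ([:-z, 1:] * q)"
      by (simp only: q'_def mult_smult_left mult_smult_right smult_smult mult.commute[of "- z"])
    then show ?thesis
      using r by (simp add: q)
  qed
  have "q \<noteq> 0"
    using Suc.prems(1) q by auto
  then have "degree p = Suc (degree q)"
    unfolding q by (subst degree_mult_eq) auto
  then have dq: "degree q' = n"
    using r Suc.hyps(2) by (simp add: q'_def)
  obtain zs where zs: "length zs = degree q'" "\<forall>z\<in>set zs. z > 0" "q' = linear_prod (map complex_of_real zs)"
  proof (atomize_elim, rule Suc.hyps(1))
    show "coeff q' 0 = 1"
      using Suc.prems(1) p by simp
    show "\<exists>r<0. z = complex_of_real r" if "poly q' z = 0" for z
      using Suc.prems(2)[of z] that p by simp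
  qed (use dq in auto)
  show ?case
  proof (intro exI[of _ "(- 1 / r) # zs"] conjI)
    show "p = linear_prod (map complex_of_real ((- 1 / r) # zs))"
      unfolding p zs(3) by simp
  qed (use zs dq Suc.hyps(2) r in \<open>auto simp: divide_simps\<close>)
qed

text \<open>The polynomial p at z is the symmetric form of the product of the 1 + w X, evaluated at
  the points x z with x in \<open>xs\<close>. For Im z > 0 these points lie in the upper half-plane,
  where that product has no zero, so p(z) is nonzero by Grace-Walsh-Szego. Conjugation excludes the
  lower half-plane and positive coefficients exclude z \<ge> 0. All roots are therefore negative,
  and their negated reciprocals are the entries of \<open>zs\<close>.\<close>

theorem finite_free_product:
  fixes xs ws :: "real list"
  assumes xs: "length xs = n" "\<forall>x\<in>set xs. x > 0" and ws: "length ws = n" "\<forall>w\<in>set ws. w > 0"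
  shows "\<exists>zs :: real list. length zs = n \<and> (\<forall>z\<in>set zs. z > 0) \<and>
    (\<forall>k\<le>n. esym zs k * real (n choose k) = esym xs k * esym ws k)"
proof -
  define b where "b k = complex_of_real (esym ws k / (n choose k))" for k
  define c where "c k = (if k \<le> n then esym xs k * (esym ws k / (n choose k)) else 0)" for k
  define p where "p = (\<Sum>k\<le>n. monom (complex_of_real (c k)) k)"
  have cp: "coeff p k = c k" for k
    by (auto simp: p_def coeff_sum c_def if_distrib cong: if_cong)
  have cpos: "c k > 0" if "k \<le> n" for k
    using that esym_pos xs ws by (auto simp: c_def)
  have poly_p: "poly p z = (\<Sum>k\<le>n. complex_of_real (c k) * z ^ k)" for z :: complex
    by (simp add: p_def poly_sum poly_monom)
  have bp: "binom_poly n b = linear_prod (map complex_of_real ws)"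
  proof (rule poly_eqI)
    fix k
    show "coeff (binom_poly n b) k = esym (map complex_of_real ws) k"
      using esym_of_real[of 1 ws k] esym_eq_0[of ws k] ws(1)
      by (cases "k \<le> n") (auto simp: coeff_binom_poly b_def)
  qed
  have upper: "poly p z \<noteq> 0" if z: "Im z > 0" for z
  proof -
    have "(\<Sum>k\<le>n. esym (map (\<lambda>x. complex_of_real x * z) xs) k * b k) \<noteq> 0"
    proof (rule grace_walsh_szego_half_plane)
      fix v :: complex assume v: "Im v > 0"
      have "1 + of_real w * v \<noteq> 0" if "w \<in> set ws" for w
      proof
        assume "1 + of_real w * v = 0"
        then have "Im (1 + of_real w * v) = 0" by simp
        then show False using v that ws(2) by auto
      qed
      note nz = this
      have "poly (linear_prod (map complex_of_real us)) v \<noteq> 0" if "set us \<subseteq> set ws" for us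
        using that
      proof (induction us)
        case (Cons u us)
        have "poly [:1, complex_of_real u:] v \<noteq> 0"
          using Cons.prems nz[of u] by (simp add: mult.commute)
        then show ?case
          using Cons by (simp only: list.map linear_prod_Cons poly_mult) simp
      qed auto
      then show "poly (binom_poly n b) v \<noteq> 0"
        unfolding bp by blast
    qed (use xs z in auto)
    also have "(\<Sum>k\<le>n. esym (map (\<lambda>x. complex_of_real x * z) xs) k * b k) = poly p z"
      unfolding poly_p by (intro sum.cong) (auto simp: b_def c_def esym_of_real)
    finally show ?thesis .
  qed
  have real_neg: "\<exists>r<0. z = complex_of_real r" if "poly p z = 0" for z
  proof -
    have "poly p (cnj z) = cnj (poly p z)"
      by (simp add: poly_p)
    then have "Im z = 0"
      using upper[of z] upper[of "cnj z"] that by force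
    then have z: "z = complex_of_real (Re z)"
      by (simp add: complex_eq_iff)
    have "Re z < 0"
    proof (rule ccontr)
      assume "\<not> Re z < 0"
      then have "(\<Sum>k\<le>n. c k * Re z ^ k) \<ge> (\<Sum>k\<in>{0}. c k * Re z ^ k)"
        using cpos by (intro sum_mono2) (auto intro!: mult_nonneg_nonneg less_imp_le[OF cpos])
      then have "(\<Sum>k\<le>n. c k * Re z ^ k) > 0"
        using cpos[of 0] by simp
      moreover have "poly p z = complex_of_real (\<Sum>k\<le>n. c k * Re z ^ k)"
        unfolding poly_p by (subst (1) z) simp
      ultimately show False
        using that by (metis of_real_eq_0_iff less_irrefl)
    qed
    then show ?thesis using z by blast
  qed
  have "coeff p 0 = 1"
    by (simp add: cp c_def)
  then obtain zs where zs: "length zs = degree p" "\<forall>z\<in>set zs. z > 0" "p = linear_prod (map complex_of_real zs)"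
    using linear_prod_exists[OF _ real_neg] by blast
  have "degree p = n"
    using cpos[of n] by (intro antisym degree_le le_degree) (auto simp: cp c_def)
  moreover have "esym zs k = c k" for k
    using cp[of k] esym_of_real[of 1 zs k] unfolding zs(3) by simp
  ultimately show ?thesis
    using zs by (intro exI[of _ zs]) (auto simp: c_def)
qed

section \<open>The transform of a measure on the half-line\<close>

text \<open>Truncating s at 0 makes the kernel bounded and continuous on the whole line, as weak
  convergence of measures on the reals requires.\<close>
definition kern :: "real \<Rightarrow> real \<Rightarrow> real" where
  "kern y s = y * max 0 s / (1 + y * max 0 s)"

definition tau :: "real measure \<Rightarrow> real \<Rightarrow> real" where
  "tau \<mu> y = (\<integral>s. kern y s \<partial>\<mu>)"

section \<open>Estimates for the kernel\<close>

lemma kern_denom_pos: "(y::real) \<ge> 0 \<Longrightarrow> 1 + y * max 0 s > 0"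
  by (rule add_pos_nonneg) auto

lemma kern_nonneg: "y \<ge> 0 \<Longrightarrow> kern y s \<ge> 0"
  using kern_denom_pos[of y s] by (auto simp: kern_def)

lemma kern_less_1: "y \<ge> 0 \<Longrightarrow> kern y s < 1"
  using kern_denom_pos[of y s] by (auto simp: kern_def)

lemma norm_kern_le: "y \<ge> 0 \<Longrightarrow> norm (kern y s) \<le> 1"
  using kern_nonneg[of y s] kern_less_1[of y s] by auto

lemma kern_diff:
  assumes "y \<ge> 0" "z \<ge> 0"
  shows "kern z s - kern y s = (z - y) * max 0 s / ((1 + y * max 0 s) * (1 + z * max 0 s))"
  using kern_denom_pos[of y s] kern_denom_pos[of z s] assms
  unfolding kern_def by (simp add: divide_simps) (simp add: algebra_simps)

lemma kern_mono:
  assumes "0 \<le> y" "y \<le> z"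
  shows "kern y s \<le> kern z s"
proof -
  have "kern z s - kern y s \<ge> 0"
    using assms kern_denom_pos[of y s] kern_denom_pos[of z s]
    by (subst kern_diff) (auto intro!: divide_nonneg_nonneg mult_nonneg_nonneg)
  then show ?thesis by simp
qed

lemma kern_strict_mono:
  assumes "0 \<le> y" "y < z" "s > 0"
  shows "kern y s < kern z s"
proof -
  have "kern z s - kern y s > 0"
    using assms kern_denom_pos[of y s] kern_denom_pos[of z s]
    by (subst kern_diff) (auto intro!: divide_pos_pos mult_pos_pos)
  then show ?thesis by simp
qed

text \<open>The bound is uniform in s, so it integrates to a local Lipschitz estimate for
  \<open>tau \<mu>\<close> even when \<mu> has no moments.\<close>

lemma kern_diff_le:
  assumes "0 < y" "y \<le> z"
  shows "kern z s - kern y s \<le> (z - y) / y"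
proof -
  have "kern z s - kern y s = (z - y) / y * (kern y s * (1 / (1 + z * max 0 s)))"
    using assms by (subst kern_diff) (auto simp: kern_def)
  also have "\<dots> \<le> (z - y) / y * (1 * 1)"
    using assms kern_less_1[of y s] kern_nonneg[of y s] kern_denom_pos[of z s]
    by (intro mult_left_mono mult_mono) (auto simp: divide_simps)
  finally show ?thesis by simp
qed

lemma kern_scale: "c > 0 \<Longrightarrow> kern y (s / c) = kern (y / c) s"
  by (auto simp: kern_def max_def field_simps)

lemma isCont_kern: "y \<ge> 0 \<Longrightarrow> isCont (kern y) s"
  unfolding kern_def using kern_denom_pos[of y s] by (intro continuous_intros) auto

lemma borel_measurable_kern [measurable]: "y \<ge> 0 \<Longrightarrow> kern y \<in> borel_measurable borel"
  by (intro borel_measurable_continuous_onI continuous_at_imp_continuous_on) (auto intro: isCont_kern)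

lemma prob_nonnegD: "prob_nonneg \<mu> \<Longrightarrow> real_distribution \<mu>"
  by (simp add: prob_nonneg_def)

section \<open>Monotonicity, continuity and range of the transform\<close>

lemma integrable_kern:
  assumes "real_distribution \<mu>" "y \<ge> 0"
  shows "integrable \<mu> (kern y)"
proof -
  interpret real_distribution \<mu> by fact
  show ?thesis
    using borel_measurable_kern[OF assms(2)] norm_kern_le[OF assms(2)]
    by (intro integrable_const_bound[of _ 1]) auto
qed

lemma tau_mono:
  assumes "real_distribution \<mu>" "0 \<le> y" "y \<le> z"
  shows "tau \<mu> y \<le> tau \<mu> z"
  unfolding tau_def using assms by (intro integral_mono integrable_kern kern_mono) auto

lemma tau_less_1:
  assumes "real_distribution \<mu>" "y \<ge> 0"
  shows "tau \<mu> y < 1"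
proof -
  interpret real_distribution \<mu> by fact
  have "(\<integral>s. kern y s \<partial>\<mu>) < (\<integral>s. 1 \<partial>\<mu>)"
    using kern_less_1[OF assms(2)]
    by (intro integral_less_AE_space integrable_kern assms) (use emeasure_space_1 in \<open>auto simp del: space_eq_univ\<close>)
  then show ?thesis using prob_space by (simp add: tau_def)
qed

lemma tau_diff_le:
  assumes "real_distribution \<mu>" "0 < y" "y \<le> z"
  shows "tau \<mu> z - tau \<mu> y \<le> (z - y) / y"
proof -
  interpret real_distribution \<mu> by fact
  have "tau \<mu> z - tau \<mu> y = (\<integral>s. kern z s - kern y s \<partial>\<mu>)"
    unfolding tau_def using assms by (subst Bochner_Integration.integral_diff) (auto intro!: integrable_kern)
  also have "\<dots> \<le> (\<integral>s. (z - y) / y \<partial>\<mu>)"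
    using assms by (intro integral_mono kern_diff_le Bochner_Integration.integrable_diff integrable_kern) auto
  finally show ?thesis using prob_space by simp
qed

lemma isCont_tau:
  assumes \<mu>: "real_distribution \<mu>" and "y > 0"
  shows "isCont (tau \<mu>) y"
proof -
  have "((\<lambda>z. tau \<mu> z - tau \<mu> y) \<longlongrightarrow> 0) (at y)"
  proof (rule Lim_null_comparison)
    have "\<forall>\<^sub>F z in at y. z > y / 2"
      using \<open>y > 0\<close> by (intro order_tendstoD(1)[OF tendsto_ident_at]) auto
    then show "\<forall>\<^sub>F z in at y. norm (tau \<mu> z - tau \<mu> y) \<le> \<bar>z - y\<bar> / (y / 2)"
    proof eventually_elim
      case (elim z)
      show ?case
      proof (cases "z \<ge> y")
        case True
        have "tau \<mu> z - tau \<mu> y \<le> (z - y) / y"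
          using True assms by (intro tau_diff_le) auto
        also have "\<dots> \<le> (z - y) / (y / 2)"
          using True \<open>y > 0\<close> by (intro divide_left_mono) auto
        finally show ?thesis
          using True tau_mono[OF \<mu>, of y z] \<open>y > 0\<close> by auto
      next
        case False
        have "tau \<mu> y - tau \<mu> z \<le> (y - z) / z"
          using False elim assms by (intro tau_diff_le) auto
        also have "\<dots> \<le> (y - z) / (y / 2)"
          using False elim \<open>y > 0\<close> by (intro divide_left_mono) auto
        finally show ?thesis
          using False tau_mono[OF \<mu>, of z y] elim \<open>y > 0\<close> by auto
      qed
    qed
    show "((\<lambda>z. \<bar>z - y\<bar> / (y / 2)) \<longlongrightarrow> 0) (at y)"
      using \<open>y > 0\<close> by (auto intro!: tendsto_eq_intros)
  qed
  then show ?thesis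
    by (simp add: isCont_def LIM_zero_iff)
qed

lemma tau_small:
  assumes \<mu>: "real_distribution \<mu>" and "\<epsilon> > 0"
  obtains y where "y > 0" "tau \<mu> y < \<epsilon>"
proof -
  interpret real_distribution \<mu> by fact
  have "(\<lambda>n. tau \<mu> (1 / real (Suc n))) \<longlonglongrightarrow> (\<integral>s. 0 \<partial>\<mu>)"
    unfolding tau_def
  proof (rule integral_dominated_convergence[where w = "\<lambda>_. 1"])
    have "(\<lambda>n. kern (1 / real (Suc n)) s) \<longlonglongrightarrow> 0" for s
    proof (cases "s > 0")
      case True
      have "(\<lambda>n. s / (real (Suc n) + s)) \<longlonglongrightarrow> 0"
        by real_asymp
      moreover have "kern (1 / real (Suc n)) s = s / (real (Suc n) + s)" for n
        using True by (simp add: kern_def divide_simps)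
      ultimately show ?thesis by simp
    qed (simp add: kern_def)
    then show "AE s in \<mu>. (\<lambda>n. kern (1 / real (Suc n)) s) \<longlonglongrightarrow> 0"
      by simp
    show "AE s in \<mu>. norm (kern (1 / real (Suc n)) s) \<le> 1" for n
      using norm_kern_le by simp
  qed (use borel_measurable_kern in auto)
  then have "\<forall>\<^sub>F n in sequentially. tau \<mu> (1 / real (Suc n)) < \<epsilon>"
    using \<open>\<epsilon> > 0\<close> by (intro order_tendstoD) auto
  then obtain n where "tau \<mu> (1 / real (Suc n)) < \<epsilon>"
    by (meson eventually_happens' sequentially_bot)
  then show ?thesis
    by (intro that[of "1 / real (Suc n)"]) auto
qed

lemma tau_attains:
  assumes \<mu>: "real_distribution \<mu>" and t: "0 < t" "t \<le> tau \<mu> z" and z: "z > 0"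
  obtains y where "0 < y" "y \<le> z" "tau \<mu> y = t"
proof -
  obtain x where x: "x > 0" "tau \<mu> x < t"
    using tau_small[OF \<mu> t(1)] .
  have "x \<le> z"
    using tau_mono[OF \<mu>, of z x] x z t by force
  then have "\<exists>y\<ge>x. y \<le> z \<and> tau \<mu> y = t"
    using x t by (intro IVT) (auto intro!: isCont_tau \<mu>)
  then obtain y where "x \<le> y" "y \<le> z" "tau \<mu> y = t"
    by blast
  with x show ?thesis
    by (intro that[of y]) auto
qed

section \<open>Strict monotonicity and the S-transform\<close>

lemma prob_nonneg_AE: "prob_nonneg \<mu> \<Longrightarrow> AE s in \<mu>. s \<ge> 0"
proof -
  assume *: "prob_nonneg \<mu>"
  interpret real_distribution \<mu> using * by (rule prob_nonnegD)
  have "{..<0} \<in> null_sets \<mu>"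
    using * by (auto simp: prob_nonneg_def null_sets_def emeasure_eq_measure)
  from AE_not_in[OF this] show ?thesis
    by eventually_elim auto
qed

lemma eq_delta0_if_AE_nonpos:
  assumes "prob_nonneg \<mu>" "AE s in \<mu>. s \<le> 0"
  shows "\<mu> = delta0"
proof -
  interpret real_distribution \<mu> using assms(1) by (rule prob_nonnegD)
  have ae: "AE s in \<mu>. s = 0"
    using prob_nonneg_AE[OF assms(1)] assms(2) by eventually_elim auto
  show ?thesis
    unfolding delta0_def
  proof (rule measure_eqI)
    fix A assume "A \<in> sets \<mu>"
    then have A: "A \<in> sets borel" by simp
    have "emeasure \<mu> A = emeasure \<mu> (if 0 \<in> A then UNIV else {})"
      using ae A by (intro emeasure_eq_AE) (auto elim!: eventually_mono)
    then show "emeasure \<mu> A = emeasure (return borel 0) A"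
      using A emeasure_space_1 by (auto simp: emeasure_return indicator_def)
  qed simp
qed

lemma tau_strict_mono:
  assumes \<mu>: "prob_nonneg \<mu>" "\<mu> \<noteq> delta0" and y: "0 \<le> y" "y < z"
  shows "tau \<mu> y < tau \<mu> z"
proof (rule ccontr)
  interpret real_distribution \<mu> using \<mu>(1) by (rule prob_nonnegD)
  have int: "integrable \<mu> (kern y)" "integrable \<mu> (kern z)"
    using y by (auto intro!: integrable_kern real_distribution_axioms)
  assume "\<not> tau \<mu> y < tau \<mu> z"
  then have "(\<integral>s. kern z s - kern y s \<partial>\<mu>) = 0"
    using tau_mono[OF real_distribution_axioms y(1), of z] y int
    unfolding tau_def by (subst Bochner_Integration.integral_diff) auto
  then have "AE s in \<mu>. kern z s - kern y s = 0"
    using int kern_mono[OF y(1), of z] y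
    by (subst (asm) integral_nonneg_eq_0_iff_AE) auto
  then have "AE s in \<mu>. s \<le> 0"
  proof eventually_elim
    case (elim s)
    then show ?case
      using kern_strict_mono[OF y, of s] by (cases "s \<le> 0") auto
  qed
  then show False
    using eq_delta0_if_AE_nonpos \<mu> by blast
qed

lemma tau_0 [simp]: "tau \<mu> 0 = 0"
  by (simp add: tau_def kern_def)

lemma tau_pos: "prob_nonneg \<mu> \<Longrightarrow> \<mu> \<noteq> delta0 \<Longrightarrow> y > 0 \<Longrightarrow> tau \<mu> y > 0"
  using tau_strict_mono[of \<mu> 0 y] by simp

lemma tau_delta0: "y \<ge> 0 \<Longrightarrow> tau delta0 y = 0"
  unfolding tau_def delta0_def using borel_measurable_kern[of y]
  by (subst integral_return) (auto simp: kern_def)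

lemma psi_tr_eq_tau:
  assumes "prob_nonneg \<mu>" "y > 0"
  shows "psi_tr \<mu> (- y) = - tau \<mu> y"
proof -
  interpret real_distribution \<mu> using assms(1) by (rule prob_nonnegD)
  have "psi_tr \<mu> (- y) = (\<integral>s. - kern y s \<partial>\<mu>)"
    unfolding psi_tr_def
  proof (rule integral_cong_AE)
    show "AE s in \<mu>. - y * s / (1 - - y * s) = - kern y s"
      using prob_nonneg_AE[OF assms(1)] by eventually_elim (simp add: kern_def)
  qed (use borel_measurable_kern[of y] assms in auto)
  then show ?thesis by (simp add: tau_def)
qed

text \<open>Strict monotonicity of \<open>tau\<close> makes -y the only negative solution in the
  definite description, so chi(-t) = -y for t = \<open>tau \<mu> y\<close>. This turns identities
  between S-transforms into identities between the points where the transforms take the value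
  t.\<close>

lemma S_tr_eq:
  assumes \<mu>: "prob_nonneg \<mu>" "\<mu> \<noteq> delta0" and y: "y > 0"
  shows "S_tr \<mu> (- tau \<mu> y) = y * (1 - tau \<mu> y) / tau \<mu> y"
proof -
  have "(THE x. x < 0 \<and> psi_tr \<mu> x = - tau \<mu> y) = - y"
  proof (rule the_equality)
    show "- y < 0 \<and> psi_tr \<mu> (- y) = - tau \<mu> y"
      using psi_tr_eq_tau \<mu> y by auto
    fix x assume x: "x < 0 \<and> psi_tr \<mu> x = - tau \<mu> y"
    then have "tau \<mu> (- x) = tau \<mu> y"
      using psi_tr_eq_tau[OF \<mu>(1), of "- x"] by simp
    then show "x = - y"
      using tau_strict_mono[OF \<mu>, of "-x" y] tau_strict_mono[OF \<mu>, of y "-x"] x y by force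
  qed
  then show ?thesis
    by (simp add: S_tr_def)
qed

section \<open>Weak convergence, dilation and tightness\<close>

lemma tau_weak_conv:
  assumes "\<And>n. real_distribution (M n)" "real_distribution \<mu>" "weak_conv_m M \<mu>" "y \<ge> 0"
  shows "(\<lambda>n. tau (M n) y) \<longlonglongrightarrow> tau \<mu> y"
  unfolding tau_def using assms
  by (intro weak_conv_imp_integral_bdd_continuous_conv[where B = 1]) (auto intro: isCont_kern norm_kern_le simp del: real_norm_def)

lemma real_distribution_dil: "real_distribution \<mu> \<Longrightarrow> real_distribution (dil c \<mu>)"
proof -
  assume "real_distribution \<mu>"
  then interpret real_distribution \<mu> .
  show ?thesis
    unfolding dil_def by (intro real_distribution_distr) auto
qed

lemma tau_dil:
  assumes "real_distribution \<mu>" "c > 0" "y \<ge> 0"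
  shows "tau (dil c \<mu>) y = tau \<mu> (y / c)"
proof -
  interpret real_distribution \<mu> by fact
  show ?thesis
    unfolding tau_def dil_def using borel_measurable_kern[of y] assms
    by (subst integral_distr) (auto simp: kern_scale)
qed

lemma prob_nonneg_dil:
  assumes "prob_nonneg \<mu>" "c > 0"
  shows "prob_nonneg (dil c \<mu>)"
proof -
  interpret real_distribution \<mu> using assms(1) by (rule prob_nonnegD)
  have "(\<lambda>t. t / c) -` {..<0} = {..<0}"
    using assms(2) by (auto simp: divide_less_0_iff)
  then have "measure (dil c \<mu>) {..<0} = measure \<mu> {..<0}"
    unfolding dil_def by (subst measure_distr) auto
  then show ?thesis
    using assms real_distribution_dil[OF real_distribution_axioms, of c] by (simp add: prob_nonneg_def)
qed

text \<open>Markov's inequality: kern y is at least 1/2 beyond 1/y.\<close>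
lemma tail_le_tau:
  assumes \<mu>: "real_distribution \<mu>" and y: "y > 0"
  shows "measure \<mu> {1 / y<..} \<le> 2 * tau \<mu> y"
proof -
  interpret real_distribution \<mu> by fact
  have "measure \<mu> {1 / y<..} = (\<integral>s. indicator {1 / y<..} s \<partial>\<mu>)"
    by simp
  also have "\<dots> \<le> (\<integral>s. 2 * kern y s \<partial>\<mu>)"
  proof (intro integral_mono)
    fix s
    show "indicator {1 / y<..} s \<le> 2 * kern y s"
    proof (cases "1 / y < s")
      case True
      moreover have "0 < 1 / y" using y by simp
      ultimately have "0 < s" "1 \<le> y * s" using y by (linarith, simp add: field_simps)
      then show ?thesis
        using True by (auto simp: kern_def field_simps)
    qed (use kern_nonneg[of y s] y in auto)
  qed (use integrable_kern[OF \<mu>, of y] y in \<open>auto intro!: integrable_real_indicator simp: less_top[symmetric]\<close>)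
  finally show ?thesis by (simp add: tau_def)
qed

text \<open>By \<open>tail_le_tau\<close> a common point x with all \<open>tau (M n) x\<close> small
  gives a common tail bound. The hypothesis provides such a point only for late n; each of the
  finitely many others has its own by \<open>tau_small\<close>, and the minimum serves for all by
  monotonicity.\<close>

lemma tight_if_tau:
  assumes M: "\<And>n. prob_nonneg (M n)"
    and ev: "\<And>\<epsilon>. \<epsilon> > 0 \<Longrightarrow> \<exists>y>0. \<forall>\<^sub>F n in sequentially. tau (M n) y < \<epsilon>"
  shows "tight M"
  unfolding tight_def
proof (intro conjI allI impI)
  show rd: "real_distribution (M n)" for n
    using M by (rule prob_nonnegD)
  fix \<epsilon> :: real assume "\<epsilon> > 0"
  obtain y N where y: "y > 0" "\<And>n. n \<ge> N \<Longrightarrow> tau (M n) y < \<epsilon> / 2"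
    using ev[of "\<epsilon> / 2"] \<open>\<epsilon> > 0\<close> by (auto simp: eventually_sequentially)
  have "\<exists>z>0. tau (M n) z < \<epsilon> / 2" for n
    using tau_small[OF rd, of "\<epsilon> / 2" n] \<open>\<epsilon> > 0\<close> by (metis half_gt_zero)
  then obtain z where z: "\<And>n. z n > 0" "\<And>n. tau (M n) (z n) < \<epsilon> / 2"
    by metis
  define x where "x = Min (insert y (z ` {..<N}))"
  have x: "x > 0"
    using y z by (auto simp: x_def)
  have small: "tau (M n) x < \<epsilon> / 2" for n
  proof (cases "n < N")
    case True
    then have "x \<le> z n" by (auto simp: x_def)
    then show ?thesis using tau_mono[OF rd, of x "z n" n] x z(2)[of n] by linarith
  next
    case False
    have "x \<le> y" by (auto simp: x_def)
    then show ?thesis using tau_mono[OF rd, of x y n] x y(2)[of n] False by linarith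
  qed
  \<comment> \<open>The intervals in \<open>tight\<close> are open on the left; the end -1 keeps a
    possible atom at 0 inside.\<close>
  show "\<exists>a b. a < b \<and> (\<forall>n. 1 - \<epsilon> < measure (M n) {a<..b})"
  proof (intro exI conjI allI)
    have "0 < 1 / x" using x by simp
    then show "-1 < 1 / x" by linarith
    fix n
    interpret real_distribution "M n" by (rule rd)
    have "measure (M n) {..-1} \<le> measure (M n) {..<0}"
      by (intro finite_measure_mono) auto
    then have "measure (M n) {..-1} = 0"
      using M[of n] measure_nonneg[of "M n" "{..-1}"] unfolding prob_nonneg_def by linarith
    moreover have "measure (M n) {1 / x<..} < \<epsilon>"
      using tail_le_tau[OF rd x, of n] small[of n] by linarith
    moreover have "1 = measure (M n) ({..-1} \<union> {-1<..1/x} \<union> {1/x<..})"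
    proof -
      have "{..-1} \<union> {-1<..1/x} \<union> {1/x<..} = (UNIV :: real set)"
        using \<open>-1 < 1 / x\<close> by auto
      then show ?thesis using prob_space by simp
    qed
    moreover have "\<dots> \<le> measure (M n) {..-1} + measure (M n) {-1<..1/x} + measure (M n) {1/x<..}"
      by (intro order.trans[OF measure_Un_le] add_mono measure_Un_le) auto
    ultimately show "1 - \<epsilon> < measure (M n) {-1<..1/x}"
      by linarith
  qed
qed

section \<open>Injectivity of the transform\<close>

text \<open>Once the earlier coefficients vanish, division by x^n leaves a series with constant term
  \<open>d n\<close> that sums to 0 for small nonzero x; its limit at 0 is
  \<open>d n\<close>.\<close>

lemma powser_eq_0_imp_coeff_eq_0:
  fixes d :: "nat \<Rightarrow> real"
  assumes "s > 0" and sums: "\<And>x. x \<noteq> 0 \<Longrightarrow> norm x < s \<Longrightarrow> (\<lambda>n. d n * x ^ n) sums 0"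
  shows "d n = 0"
proof (induction n rule: less_induct)
  case (less n)
  have "((\<lambda>_. 0) \<longlongrightarrow> d (0 + n)) (at (0::real))"
  proof (rule powser_limit_0_strong[OF \<open>s > 0\<close>, of "\<lambda>i. d (i + n)"])
    fix x :: real assume x: "x \<noteq> 0" "norm x < s"
    have "(\<Sum>i<n. d i * x ^ i) = 0"
      using less by (intro sum.neutral) auto
    then have "(\<lambda>i. d (i + n) * x ^ (i + n)) sums 0"
      using sums_split_initial_segment[OF sums[OF x], of n] by simp
    then have "(\<lambda>i. d (i + n) * x ^ (i + n) / x ^ n) sums (0 / x ^ n)"
      by (rule sums_divide)
    then show "(\<lambda>i. d (i + n) * x ^ i) sums 0"
      using x by (simp add: power_add)
  qed
  then show ?case
    by (simp add: tendsto_const_iff)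
qed

text \<open>With v = \<open>kern y s\<close> the right side is (1 - v) / (1 - w v), a geometric
  series. Integrated over s, it shows that the Taylor expansion of \<open>tau\<close> at y encodes
  moments of the bounded variable v.\<close>

lemma kern_affine_sums:
  assumes y: "y > 0" and w: "\<bar>w\<bar> < 1"
  shows "(\<lambda>n. w ^ n * ((1 - kern y s) * kern y s ^ n)) sums (1 - kern (y * (1 - w)) s)"
proof -
  have v: "0 \<le> kern y s" "kern y s < 1"
    using kern_nonneg kern_less_1 y by auto
  have "\<bar>w * kern y s\<bar> = \<bar>w\<bar> * kern y s"
    using v by (simp add: abs_mult)
  also have "\<dots> \<le> \<bar>w\<bar> * 1"
    using v by (intro mult_left_mono) auto
  finally have less: "\<bar>w * kern y s\<bar> < 1"
    using w by simp
  have "(\<lambda>n. (1 - kern y s) * (w * kern y s) ^ n) sums ((1 - kern y s) * (1 / (1 - w * kern y s)))"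
    using less by (intro sums_mult geometric_sums) auto
  also have "(\<lambda>n. (1 - kern y s) * (w * kern y s) ^ n) = (\<lambda>n. w ^ n * ((1 - kern y s) * kern y s ^ n))"
    by (simp add: power_mult_distrib mult_ac)
  also have "(1 - kern y s) * (1 / (1 - w * kern y s)) = 1 - kern (y * (1 - w)) s"
  proof -
    define m where "m = max 0 s"
    have pos: "1 + y * m > 0" "1 + y * (1 - w) * m > 0"
      using y w by (auto intro!: add_pos_nonneg mult_nonneg_nonneg simp: m_def)
    have "1 - kern y s = 1 / (1 + y * m)"
      using pos by (simp add: kern_def m_def[symmetric] field_simps)
    moreover have "1 - w * kern y s = (1 + y * (1 - w) * m) / (1 + y * m)"
      using pos by (simp add: kern_def m_def[symmetric] field_simps)
    moreover have "1 - kern (y * (1 - w)) s = 1 / (1 + y * (1 - w) * m)"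
      using pos(2) unfolding kern_def m_def[symmetric] by (simp add: divide_simps)
    ultimately show ?thesis
      using pos by simp
  qed
  finally show ?thesis .
qed

lemma integrable_kern_power:
  assumes "real_distribution \<mu>" "y \<ge> 0"
  shows "integrable \<mu> (\<lambda>s. kern y s ^ n)" "integrable \<mu> (\<lambda>s. (1 - kern y s) * kern y s ^ n)"
proof -
  interpret real_distribution \<mu> by fact
  have b: "0 \<le> kern y s" "kern y s \<le> 1" for s
    using kern_nonneg[of y s] kern_less_1[of y s] assms by auto
  note [measurable] = borel_measurable_kern[OF assms(2)]
  show "integrable \<mu> (\<lambda>s. kern y s ^ n)"
    using b by (intro integrable_const_bound[of _ 1]) (auto intro!: power_le_one)
  show "integrable \<mu> (\<lambda>s. (1 - kern y s) * kern y s ^ n)"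
    using b by (intro integrable_const_bound[of _ 1]) (auto simp: abs_mult intro!: mult_le_one power_le_one)
qed

lemma tau_sums:
  assumes \<mu>: "real_distribution \<mu>" and y: "y > 0" and w: "\<bar>w\<bar> < 1"
  shows "(\<lambda>n. (\<integral>s. (1 - kern y s) * kern y s ^ n \<partial>\<mu>) * w ^ n) sums (1 - tau \<mu> (y * (1 - w)))"
proof -
  interpret real_distribution \<mu> by fact
  note int = integrable_kern_power[OF \<mu>, of y]
  have b: "0 \<le> kern y s" "kern y s \<le> 1" for s
    using kern_nonneg[of y s] kern_less_1[of y s] y by auto
  have nb: "norm (w ^ n * ((1 - kern y s) * kern y s ^ n)) \<le> \<bar>w\<bar> ^ n" for n s
    using mult_left_mono[OF mult_le_one[of "1 - kern y s" "kern y s ^ n"], of "\<bar>w\<bar> ^ n"] b[of s]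
    by (auto simp: abs_mult power_abs intro!: power_le_one)
  have sw: "summable (\<lambda>n. \<bar>w\<bar> ^ n)"
    using w by (intro summable_geometric) auto
  have "(\<lambda>n. \<integral>s. w ^ n * ((1 - kern y s) * kern y s ^ n) \<partial>\<mu>) sums (\<integral>s. (\<Sum>n. w ^ n * ((1 - kern y s) * kern y s ^ n)) \<partial>\<mu>)"
  proof (rule sums_integral)
    show i: "integrable \<mu> (\<lambda>s. w ^ n * ((1 - kern y s) * kern y s ^ n))" for n
      using int y by auto
    show "AE s in \<mu>. summable (\<lambda>n. norm (w ^ n * ((1 - kern y s) * kern y s ^ n)))"
      using nb by (intro AE_I2 summable_comparison_test'[OF sw]) auto
    show "summable (\<lambda>n. \<integral>s. norm (w ^ n * ((1 - kern y s) * kern y s ^ n)) \<partial>\<mu>)"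
    proof (rule summable_comparison_test'[OF sw])
      fix n
      have "(\<integral>s. norm (w ^ n * ((1 - kern y s) * kern y s ^ n)) \<partial>\<mu>) \<le> (\<integral>s. \<bar>w\<bar> ^ n \<partial>\<mu>)"
        using i nb by (intro integral_mono integrable_norm) auto
      then show "norm (\<integral>s. norm (w ^ n * ((1 - kern y s) * kern y s ^ n)) \<partial>\<mu>) \<le> \<bar>w\<bar> ^ n"
        using prob_space by simp
    qed
  qed
  also have "(\<lambda>s. \<Sum>n. w ^ n * ((1 - kern y s) * kern y s ^ n)) = (\<lambda>s. 1 - kern (y * (1 - w)) s)"
    using sums_unique[OF kern_affine_sums[OF y w]] by auto
  also have "(\<integral>s. 1 - kern (y * (1 - w)) s \<partial>\<mu>) = 1 - tau \<mu> (y * (1 - w))"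
    unfolding tau_def using y w prob_space integrable_kern[OF \<mu>, of "y * (1 - w)"]
    by (subst Bochner_Integration.integral_diff) auto
  finally show ?thesis
    by (simp add: mult.commute)
qed

text \<open>The image measure under \<open>kern y\<close> lives on [0, 1], so its moment series
  converges everywhere to its characteristic function; the moments therefore determine it.\<close>

lemma char_distr_kern:
  assumes \<mu>: "real_distribution \<mu>" and y: "y > 0"
  shows "(\<lambda>n. ((\<i> * complex_of_real t) ^ n /\<^sub>R fact n) * complex_of_real (\<integral>s. kern y s ^ n \<partial>\<mu>))
           sums char (distr \<mu> borel (kern y)) t"
proof -
  interpret real_distribution \<mu> by fact
  note [measurable] = borel_measurable_kern[OF less_imp_le[OF y]]
  note int = integrable_kern_power(1)[OF \<mu> less_imp_le[OF y]]
  define g where "g n s = ((\<i> * complex_of_real t) ^ n /\<^sub>R fact n) * complex_of_real (kern y s ^ n)" for n s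
  have b: "0 \<le> kern y s" "kern y s \<le> 1" for s
    using kern_nonneg[of y s] kern_less_1[of y s] y by auto
  have nb: "norm (g n s) \<le> \<bar>t\<bar> ^ n /\<^sub>R fact n" for n s
  proof -
    have "norm (g n s) = (\<bar>t\<bar> ^ n /\<^sub>R fact n) * kern y s ^ n"
      using b[of s] by (simp add: g_def norm_mult norm_power divide_inverse power_abs)
    also have "\<dots> \<le> (\<bar>t\<bar> ^ n /\<^sub>R fact n) * 1"
      using b[of s] by (intro mult_left_mono power_le_one) auto
    finally show ?thesis by simp
  qed
  have sw: "summable (\<lambda>n. \<bar>t\<bar> ^ n /\<^sub>R fact n)"
    by (rule summable_exp_generic)
  have gi: "integrable \<mu> (g n)" for n
    unfolding g_def using int[of n] by (intro integrable_mult_right integrable_of_real)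
  have gs: "(\<lambda>n. g n s) sums iexp (t * kern y s)" for s
  proof -
    have "(\<lambda>n. (\<i> * complex_of_real (t * kern y s)) ^ n /\<^sub>R fact n) sums iexp (t * kern y s)"
      by (rule exp_converges)
    then show ?thesis
      by (simp add: g_def power_mult_distrib mult_ac)
  qed
  have "(\<lambda>n. integral\<^sup>L \<mu> (g n)) sums (\<integral>s. (\<Sum>n. g n s) \<partial>\<mu>)"
  proof (rule sums_integral[OF gi])
    show "AE s in \<mu>. summable (\<lambda>n. norm (g n s))"
      using nb by (intro AE_I2 summable_comparison_test'[OF sw]) auto
    show "summable (\<lambda>n. \<integral>s. norm (g n s) \<partial>\<mu>)"
    proof (rule summable_comparison_test'[OF sw])
      fix n
      have "(\<integral>s. norm (g n s) \<partial>\<mu>) \<le> (\<integral>s. \<bar>t\<bar> ^ n /\<^sub>R fact n \<partial>\<mu>)"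
        using gi nb by (intro integral_mono integrable_norm) auto
      then show "norm (\<integral>s. norm (g n s) \<partial>\<mu>) \<le> \<bar>t\<bar> ^ n /\<^sub>R fact n"
        using prob_space by simp
    qed
  qed
  also have "(\<lambda>s. \<Sum>n. g n s) = (\<lambda>s. iexp (t * kern y s))"
    using sums_unique[OF gs] by auto
  also have "(\<integral>s. iexp (t * kern y s) \<partial>\<mu>) = char (distr \<mu> borel (kern y)) t"
    unfolding char_def by (subst integral_distr) auto
  finally have *: "(\<lambda>n. integral\<^sup>L \<mu> (g n)) sums char (distr \<mu> borel (kern y)) t" .
  have "integral\<^sup>L \<mu> (g n) = ((\<i> * complex_of_real t) ^ n /\<^sub>R fact n) * complex_of_real (\<integral>s. kern y s ^ n \<partial>\<mu>)" for n
    unfolding g_def by (simp only: integral_mult_right_zero integral_complex_of_real)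
  with * show ?thesis
    by simp
qed

lemma kern_le_iff:
  assumes "y > 0" "x \<ge> 0"
  shows "kern y s \<le> kern y x \<longleftrightarrow> s \<le> x"
proof -
  have "kern y u = 1 - 1 / (1 + y * max 0 u)" for u
    using kern_denom_pos[of y u] assms by (simp add: kern_def field_simps)
  then have "kern y s \<le> kern y x \<longleftrightarrow> 1 / (1 + y * max 0 x) \<le> 1 / (1 + y * max 0 s)"
    by simp
  also have "\<dots> \<longleftrightarrow> 1 + y * max 0 s \<le> 1 + y * max 0 x"
    using kern_denom_pos[of y s] kern_denom_pos[of y x] assms by (simp add: divide_simps)
  also have "\<dots> \<longleftrightarrow> s \<le> x"
    using assms by auto
  finally show ?thesis .
qed

text \<open>Equality near 0 gives equal Taylor coefficients at y. These are differences m(n) - m(n +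
  1) of successive moments of the image under \<open>kern y\<close>, and m(0) = 1, so all moments
  agree. Then the characteristic functions agree, hence the images, hence the distribution
  functions, because \<open>kern y\<close> is strictly increasing on the half-line.\<close>

theorem tau_determines:
  assumes \<mu>: "prob_nonneg \<mu>" and \<nu>: "prob_nonneg \<nu>" and \<delta>: "\<delta> > 0"
    and eq: "\<And>y. 0 < y \<Longrightarrow> y < \<delta> \<Longrightarrow> tau \<mu> y = tau \<nu> y"
  shows "\<mu> = \<nu>"
proof -
  have rd: "real_distribution \<mu>" "real_distribution \<nu>"
    using \<mu> \<nu> by (auto intro: prob_nonnegD)
  interpret \<mu>: real_distribution \<mu> by fact
  interpret \<nu>: real_distribution \<nu> by fact
  \<comment> \<open>With the midpoint, y (1 - w) stays in the interval from 0 to \<delta> for all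
    |w| < 1.\<close>
  define y where "y = \<delta> / 2"
  have y: "y > 0" using \<delta> by (simp add: y_def)
  note [measurable] = borel_measurable_kern[OF less_imp_le[OF y]]
  note int = integrable_kern_power[OF _ less_imp_le[OF y]]
  define c where "c \<rho> n = (\<integral>s. (1 - kern y s) * kern y s ^ n \<partial>\<rho>)" for \<rho> n
  define m where "m \<rho> n = (\<integral>s. kern y s ^ n \<partial>\<rho>)" for \<rho> n
  have "c \<mu> n - c \<nu> n = 0" for n
  proof (rule powser_eq_0_imp_coeff_eq_0[of 1 "\<lambda>n. c \<mu> n - c \<nu> n"])
    fix w :: real assume w: "w \<noteq> 0" "norm w < 1"
    then have w1: "\<bar>w\<bar> < 1" by simp
    have pos: "0 < 1 - w" "1 - w < 2" using w1 by linarith+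
    have "y * (1 - w) < y * 2"
      using pos y by (intro mult_strict_left_mono) auto
    then have "tau \<mu> (y * (1 - w)) = tau \<nu> (y * (1 - w))"
      using pos y by (intro eq) (auto simp: y_def)
    then show "(\<lambda>n. (c \<mu> n - c \<nu> n) * w ^ n) sums 0"
      using sums_diff[OF tau_sums[OF rd(1) y w1] tau_sums[OF rd(2) y w1]]
      by (simp add: c_def left_diff_distrib)
  qed auto
  then have c: "c \<mu> n = c \<nu> n" for n
    by simp
  have m_Suc: "m \<rho> (Suc n) = m \<rho> n - c \<rho> n" if "real_distribution \<rho>" for \<rho> n
  proof -
    have "m \<rho> n - c \<rho> n = (\<integral>s. kern y s ^ n - (1 - kern y s) * kern y s ^ n \<partial>\<rho>)"
      unfolding m_def c_def using int[OF that] by (subst Bochner_Integration.integral_diff) auto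
    also have "\<dots> = m \<rho> (Suc n)"
      unfolding m_def by (simp add: left_diff_distrib)
    finally show ?thesis by simp
  qed
  have m: "m \<mu> n = m \<nu> n" for n
  proof (induction n)
    case 0
    show ?case using \<mu>.prob_space \<nu>.prob_space by (simp add: m_def)
  next
    case (Suc n)
    then show ?case using m_Suc rd c by simp
  qed
  have "char (distr \<mu> borel (kern y)) t = char (distr \<nu> borel (kern y)) t" for t
    using sums_unique2[OF char_distr_kern[OF rd(1) y, of t]] char_distr_kern[OF rd(2) y, of t] m
    unfolding m_def by simp
  then have distr: "distr \<mu> borel (kern y) = distr \<nu> borel (kern y)"
    by (intro Levy_uniqueness) auto
  have cdf_eq: "cdf \<rho> x = (if x < 0 then 0 else measure (distr \<rho> borel (kern y)) {..kern y x})"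
    if \<rho>: "prob_nonneg \<rho>" for \<rho> x
  proof (cases "x < 0")
    case True
    interpret real_distribution \<rho> using \<rho> by (rule prob_nonnegD)
    have "measure \<rho> {..x} \<le> measure \<rho> {..<0}"
      using True by (intro finite_measure_mono) auto
    then have "measure \<rho> {..x} = 0"
      using \<rho> measure_nonneg[of \<rho> "{..x}"] unfolding prob_nonneg_def by linarith
    then show ?thesis using True by (simp add: cdf_def)
  next
    case False
    interpret real_distribution \<rho> using \<rho> by (rule prob_nonnegD)
    have "kern y -` {..kern y x} = {..x}"
      using kern_le_iff[OF y, of x] False by auto
    then show ?thesis
      using False by (subst measure_distr) (auto simp: cdf_def)
  qed
  show ?thesis
    using cdf_eq[OF \<mu>] cdf_eq[OF \<nu>] distr by (intro cdf_unique rd ext) simp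
qed

section \<open>Existence of the free multiplicative convolution\<close>

text \<open>The uniform distribution is taken on positions and not on \<open>set xs\<close>, so that
  repeated entries keep their multiplicity.\<close>

definition empirical_measure :: "real list \<Rightarrow> real measure" where
  "empirical_measure xs = distr (measure_pmf (pmf_of_set {..<length xs})) borel (\<lambda>i. xs ! i)"

lemma real_distribution_empirical_measure: "real_distribution (empirical_measure xs)"
  unfolding empirical_measure_def by (intro prob_space.real_distribution_distr measure_pmf.prob_space_axioms) auto

lemma integral_empirical_measure:
  fixes f :: "real \<Rightarrow> real"
  assumes "xs \<noteq> []" "f \<in> borel_measurable borel"
  shows "(\<integral>s. f s \<partial>empirical_measure xs) = (\<Sum>x\<leftarrow>xs. f x) / length xs"
  unfolding empirical_measure_def using assms
  by (subst integral_distr)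
     (auto simp: integral_pmf_of_set lessThan_empty_iff sum_list_sum_nth atLeast0LessThan)

lemma prob_nonneg_empirical_measure:
  assumes "xs \<noteq> []" "\<forall>x\<in>set xs. x \<ge> 0"
  shows "prob_nonneg (empirical_measure xs)"
proof -
  have "measure (empirical_measure xs) {..<0} = (\<integral>s. indicator {..<0} s \<partial>empirical_measure xs)"
    by (simp add: empirical_measure_def)
  also have "\<dots> = (\<Sum>x\<leftarrow>xs. indicator {..<0} x) / length xs"
    using assms(1) by (intro integral_empirical_measure) auto
  also have "map (indicator {..<0::real}) xs = map (\<lambda>_. 0::real) xs"
    using assms(2) by (intro map_cong) auto
  finally show ?thesis
    by (simp add: prob_nonneg_def real_distribution_empirical_measure)
qed

lemma tau_empirical_measure:
  assumes "xs \<noteq> []" "\<forall>x\<in>set xs. x > 0" "y \<ge> 0"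
  shows "tau (empirical_measure xs) y = list_tau xs y / length xs"
proof -
  have "tau (empirical_measure xs) y = (\<Sum>x\<leftarrow>xs. kern y x) / length xs"
    unfolding tau_def using assms borel_measurable_kern by (intro integral_empirical_measure) auto
  also have "map (kern y) xs = map (\<lambda>x. y * x / (1 + y * x)) xs"
    using assms(2) by (intro map_cong) (auto simp: kern_def)
  finally show ?thesis
    by (simp add: list_tau_def)
qed

lemma kern_shift:
  assumes "y \<ge> 0" "d \<ge> 0"
  shows "kern y s \<le> kern y (max 0 s + d)" "kern y (max 0 s + d) \<le> kern y s + y * d"
proof -
  have pos: "1 + y * max 0 s > 0" "1 + y * (max 0 s + d) > 0"
    using assms by (auto intro!: add_pos_nonneg mult_nonneg_nonneg)
  have m: "max 0 (max 0 s + d) = max 0 s + d"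
    using assms by auto
  have eq: "kern y (max 0 s + d) - kern y s = y * d / ((1 + y * max 0 s) * (1 + y * (max 0 s + d)))"
    unfolding kern_def m using pos by (simp add: divide_simps) (simp add: algebra_simps)
  also have "\<dots> \<ge> 0"
    using pos assms by (intro divide_nonneg_pos mult_pos_pos) auto
  finally show "kern y s \<le> kern y (max 0 s + d)" by simp
  have "1 \<le> (1 + y * max 0 s) * (1 + y * (max 0 s + d))"
    using assms by (intro mult_ge1_I) auto
  then have "y * d / ((1 + y * max 0 s) * (1 + y * (max 0 s + d))) \<le> y * d / 1"
    using assms by (intro divide_left_mono) auto
  then show "kern y (max 0 s + d) \<le> kern y s + y * d"
    using eq by simp
qed

text \<open>The quantiles \<open>ys\<close> of \<mu> at equally spaced levels have empirical
  measures converging weakly to \<mu>. Truncating at 0 and adding 1 / (n + 1) makes them positive,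
  and by \<open>kern_shift\<close> this changes \<open>tau\<close> at y by at most y / (n +
  1).\<close>

lemma empirical_approximation:
  assumes \<mu>: "real_distribution \<mu>"
  shows "\<exists>xs. (\<forall>n. length (xs n) = Suc n \<and> (\<forall>x\<in>set (xs n). x > 0)) \<and>
    (\<forall>y>0. (\<lambda>n. tau (empirical_measure (xs n)) y) \<longlonglongrightarrow> tau \<mu> y)"
proof -
  interpret cdf_distribution \<mu> using \<mu> by (simp add: cdf_distribution_def)
  \<comment> \<open>\<open>I\<close> is the generalised inverse of the distribution function. The
    denominator n + 2 keeps all n + 1 levels strictly between 0 and 1.\<close>
  define ys where "ys n = map (\<lambda>i. I (real (Suc i) / real (n + 2))) [0..<Suc n]" for n
  define xs where "xs n = map (\<lambda>x. max 0 x + 1 / real (Suc n)) (ys n)" for n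
  have len: "length (ys n) = Suc n" "length (xs n) = Suc n" for n
    by (simp_all add: ys_def xs_def)
  have ne: "ys n \<noteq> []" "xs n \<noteq> []" for n
    using len[of n] by auto
  have cdf: "cdf (empirical_measure (ys n)) x = real (min (Suc n) (nat \<lfloor>real (n + 2) * cdf \<mu> x\<rfloor>)) / real (Suc n)" for n x
  proof -
    \<comment> \<open>A quantile is at most x exactly when its level is at most
      \<open>cdf \<mu> x\<close>, so counting entries up to x becomes counting levels. The minimum
      in \<open>cdf\<close> matters when \<open>cdf \<mu> x\<close> is 1, where the floor is n + 2
      but there are only n + 1 entries.\<close>
    have iff: "(ys n ! i \<le> x) = (i < nat \<lfloor>real (n + 2) * cdf \<mu> x\<rfloor>)" if "i < Suc n" for i
    proof -
      have "ys n ! i \<le> x \<longleftrightarrow> real (Suc i) / real (n + 2) \<le> cdf \<mu> x"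
        using that pseudoinverse[of "real (Suc i) / real (n + 2)" x]
        by (simp add: ys_def nth_append del: upt_Suc)
      also have "\<dots> \<longleftrightarrow> real (Suc i) \<le> real (n + 2) * cdf \<mu> x"
        by (simp add: field_simps)
      also have "\<dots> \<longleftrightarrow> i < nat \<lfloor>real (n + 2) * cdf \<mu> x\<rfloor>"
        by linarith
      finally show ?thesis .
    qed
    have "cdf (empirical_measure (ys n)) x = (\<integral>s. indicator {..x} s \<partial>empirical_measure (ys n))"
      by (simp add: cdf_def empirical_measure_def)
    also have "\<dots> = (\<Sum>i<Suc n. indicator {..x} (ys n ! i)) / real (Suc n)"
      using ne[of n] len[of n] by (subst integral_empirical_measure) (auto simp: sum_list_sum_nth atLeast0LessThan)
    also have "(\<Sum>i<Suc n. indicator {..x} (ys n ! i)) =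
        (\<Sum>i<Suc n. if i < nat \<lfloor>real (n + 2) * cdf \<mu> x\<rfloor> then 1 else 0 :: real)"
      using iff by (intro sum.cong) (auto simp: indicator_def)
    also have "\<dots> = real (card ({..<Suc n} \<inter> {i. i < nat \<lfloor>real (n + 2) * cdf \<mu> x\<rfloor>}))"
      by (subst sum.If_cases) auto
    also have "{..<Suc n} \<inter> {i. i < nat \<lfloor>real (n + 2) * cdf \<mu> x\<rfloor>} = {..<min (Suc n) (nat \<lfloor>real (n + 2) * cdf \<mu> x\<rfloor>)}"
      by auto
    finally show ?thesis by simp
  qed
  have "weak_conv_m (\<lambda>n. empirical_measure (ys n)) \<mu>"
    unfolding weak_conv_m_def weak_conv_def
  proof (intro allI impI)
    fix x
    define F where "F = cdf \<mu> x"
    have F: "0 \<le> F" "F \<le> 1"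
      by (auto simp: F_def cdf_nonneg cdf_bounded_prob)
    have b: "real (n + 2) * F - 1 \<le> real (min (Suc n) (nat \<lfloor>real (n + 2) * F\<rfloor>))"
            "real (min (Suc n) (nat \<lfloor>real (n + 2) * F\<rfloor>)) \<le> real (n + 2) * F" for n
    proof -
      define X where "X = real (n + 2) * F"
      have X: "0 \<le> X" "X - 1 \<le> real (Suc n)"
        using mult_left_mono[OF F(2), of "real (n + 2)"] F by (auto simp: X_def)
      then have eq: "real (min (Suc n) (nat \<lfloor>X\<rfloor>)) = min (real (Suc n)) (of_int \<lfloor>X\<rfloor>)"
        by (simp add: of_nat_min)
      have "X - 1 \<le> of_int \<lfloor>X\<rfloor>"
        by linarith
      with X show "real (n + 2) * F - 1 \<le> real (min (Suc n) (nat \<lfloor>real (n + 2) * F\<rfloor>))"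
        unfolding X_def[symmetric] eq by (intro min.boundedI)
      show "real (min (Suc n) (nat \<lfloor>real (n + 2) * F\<rfloor>)) \<le> real (n + 2) * F"
        unfolding X_def[symmetric] eq by (intro min.coboundedI2) simp
    qed
    show "(\<lambda>n. cdf (empirical_measure (ys n)) x) \<longlonglongrightarrow> cdf \<mu> x"
      unfolding cdf F_def[symmetric]
    proof (rule tendsto_sandwich[OF always_eventually always_eventually])
      show "\<forall>n. (real (n + 2) * F - 1) / real (Suc n) \<le> real (min (Suc n) (nat \<lfloor>real (n + 2) * F\<rfloor>)) / real (Suc n)"
        using b by (intro allI divide_right_mono) auto
      show "\<forall>n. real (min (Suc n) (nat \<lfloor>real (n + 2) * F\<rfloor>)) / real (Suc n) \<le> (real (n + 2) * F) / real (Suc n)"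
        using b by (intro allI divide_right_mono) auto
      show "(\<lambda>n. (real (n + 2) * F - 1) / real (Suc n)) \<longlonglongrightarrow> F" "(\<lambda>n. (real (n + 2) * F) / real (Suc n)) \<longlonglongrightarrow> F"
        by real_asymp+
    qed
  qed
  then have conv: "(\<lambda>n. tau (empirical_measure (ys n)) y) \<longlonglongrightarrow> tau \<mu> y" if "y > 0" for y
    using that by (intro tau_weak_conv real_distribution_empirical_measure \<mu>) auto
  have bounds: "tau (empirical_measure (ys n)) y \<le> tau (empirical_measure (xs n)) y \<and> tau (empirical_measure (xs n)) y \<le> tau (empirical_measure (ys n)) y + y / real (Suc n)"
    if "y > 0" for n y
  proof -
    have ysum: "tau (empirical_measure (ys n)) y = (\<Sum>s\<leftarrow>ys n. kern y s) / real (Suc n)"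
      unfolding tau_def using ne[of n] len[of n] that borel_measurable_kern[of y] by (subst integral_empirical_measure) auto
    have xsum: "tau (empirical_measure (xs n)) y = (\<Sum>s\<leftarrow>ys n. kern y (max 0 s + 1 / real (Suc n))) / real (Suc n)"
      unfolding tau_def using ne[of n] len[of n] that borel_measurable_kern[of y]
      by (subst integral_empirical_measure) (auto simp: xs_def o_def)
    have 1: "(\<Sum>s\<leftarrow>ys n. kern y s) \<le> (\<Sum>s\<leftarrow>ys n. kern y (max 0 s + 1 / real (Suc n)))"
      using that by (intro sum_list_mono kern_shift) auto
    have "(\<Sum>s\<leftarrow>ys n. kern y (max 0 s + 1 / real (Suc n))) \<le> (\<Sum>s\<leftarrow>ys n. kern y s + y * (1 / real (Suc n)))"
      using that by (intro sum_list_mono kern_shift) auto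
    also have "\<dots> = (\<Sum>s\<leftarrow>ys n. kern y s) + y"
      by (simp add: sum_list_addf sum_list_triv len)
    finally show ?thesis
      unfolding ysum xsum using 1 by (auto simp: divide_right_mono add_divide_distrib[symmetric])
  qed
  show ?thesis
  proof (intro exI[of _ xs] conjI allI impI)
    show "length (xs n) = Suc n" for n by (rule len)
    show "\<forall>x\<in>set (xs n). x > 0" for n
      by (auto simp: xs_def add_nonneg_pos)
    fix y :: real assume y: "y > 0"
    show "(\<lambda>n. tau (empirical_measure (xs n)) y) \<longlonglongrightarrow> tau \<mu> y"
    proof (rule tendsto_sandwich)
      show "\<forall>\<^sub>F n in sequentially. tau (empirical_measure (ys n)) y \<le> tau (empirical_measure (xs n)) y"
        "\<forall>\<^sub>F n in sequentially. tau (empirical_measure (xs n)) y \<le> tau (empirical_measure (ys n)) y + y / real (Suc n)"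
        using bounds[OF y] by simp_all
      show "(\<lambda>n. tau (empirical_measure (ys n)) y + y / real (Suc n)) \<longlonglongrightarrow> tau \<mu> y"
        using tendsto_add[OF conv[OF y] LIMSEQ_Suc[OF lim_const_over_n[of y]]] by simp
    qed (rule conv[OF y])
  qed
qed

text \<open>The bounded continuous function f is positive exactly on the negative half-line. Its
  integrals vanish along the sequence, so its integral vanishes in the limit.\<close>

lemma prob_nonneg_weak_limit:
  assumes M: "\<And>n. prob_nonneg (M n)" and \<rho>: "real_distribution \<rho>" and conv: "weak_conv_m M \<rho>"
  shows "prob_nonneg \<rho>"
proof -
  interpret real_distribution \<rho> by fact
  define f :: "real \<Rightarrow> real" where "f s = min 1 (max 0 (- s))" for s
  have f: "isCont f s" "norm (f s) \<le> 1" "f s \<ge> 0" for s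
    unfolding f_def by (auto intro!: continuous_intros)
  have fm: "f \<in> borel_measurable borel"
    by (intro borel_measurable_continuous_onI continuous_at_imp_continuous_on) (auto intro: f)
  have "(\<lambda>n. \<integral>s. f s \<partial>M n) \<longlonglongrightarrow> (\<integral>s. f s \<partial>\<rho>)"
    using weak_conv_imp_integral_bdd_continuous_conv[OF prob_nonnegD[OF M] \<rho> conv f(1,2)] .
  moreover have "(\<integral>s. f s \<partial>M n) = 0" for n
  proof (rule integral_eq_zero_AE)
    show "AE s in M n. f s = 0"
      using prob_nonneg_AE[OF M[of n]] by eventually_elim (simp add: f_def)
  qed
  ultimately have "(\<integral>s. f s \<partial>\<rho>) = 0"
    by (simp add: LIMSEQ_const_iff)
  moreover have "integrable \<rho> f"
    using f fm by (intro integrable_const_bound[of _ 1]) auto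
  ultimately have "AE s in \<rho>. f s = 0"
    using f(3) integral_nonneg_eq_0_iff_AE[of \<rho> f] by simp
  then have "AE s in \<rho>. s \<notin> {..<0}"
    by eventually_elim (auto simp: f_def min_def max_def split: if_splits)
  then have "measure \<rho> {..<0} = 0"
    by (subst prob_eq_0) auto
  then show ?thesis
    using \<rho> by (simp add: prob_nonneg_def)
qed

section \<open>Coefficient ratios at level t and the limiting product formula\<close>

lemma floor_index:
  assumes "0 < t" "t < 1"
  shows "nat \<lfloor>t * real (Suc n)\<rfloor> < Suc n" "real (nat \<lfloor>t * real (Suc n)\<rfloor>) \<le> t * real (Suc n)"
    "t * real (Suc n) < real (nat \<lfloor>t * real (Suc n)\<rfloor>) + 1"
proof -
  have 0: "0 \<le> t * real (Suc n)" "t * real (Suc n) < real (Suc n)"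
    using assms by auto
  then have *: "real (nat \<lfloor>t * real (Suc n)\<rfloor>) = of_int \<lfloor>t * real (Suc n)\<rfloor>"
    by simp
  show "real (nat \<lfloor>t * real (Suc n)\<rfloor>) \<le> t * real (Suc n)" "t * real (Suc n) < real (nat \<lfloor>t * real (Suc n)\<rfloor>) + 1"
    unfolding * by linarith+
  with 0 show "nat \<lfloor>t * real (Suc n)\<rfloor> < Suc n"
    by linarith
qed

text \<open>Contrapositive of \<open>list_tau_ge\<close>: a coefficient ratio below c would push
  \<open>list_tau\<close> at a above t (n + 1) - C, with C independent of n, although the normalised
  values tend to L < t.\<close>

lemma eventually_ratio_ge:
  fixes xs :: "nat \<Rightarrow> real list"
  assumes xs: "\<And>n. length (xs n) = Suc n" "\<And>n. \<forall>x\<in>set (xs n). x > 0"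
    and conv: "(\<lambda>n. tau (empirical_measure (xs n)) a) \<longlonglongrightarrow> L" and L: "L < t" and t: "0 < t" "t < 1"
    and c: "0 < c" "c < a"
  shows "\<forall>\<^sub>F n in sequentially. c * esym (xs n) (Suc (nat \<lfloor>t * real (Suc n)\<rfloor>)) \<le> esym (xs n) (nat \<lfloor>t * real (Suc n)\<rfloor>)"
proof -
  define C where "C = c / (a - c)"
  have "(\<lambda>n. tau (empirical_measure (xs n)) a + C / real (Suc n)) \<longlonglongrightarrow> L + 0"
    by (intro tendsto_add conv LIMSEQ_Suc[OF lim_const_over_n])
  then have "\<forall>\<^sub>F n in sequentially. tau (empirical_measure (xs n)) a + C / real (Suc n) < t"
    using L by (intro order_tendstoD) auto
  then show ?thesis
  proof eventually_elim
    case (elim n)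
    define k where "k = nat \<lfloor>t * real (Suc n)\<rfloor>"
    have k: "k < Suc n" "t * real (Suc n) < real k + 1"
      using floor_index[OF t, of n] by (auto simp: k_def)
    have ne: "xs n \<noteq> []" using xs(1)[of n] by auto
    show ?case
    proof (rule ccontr)
      assume "\<not> ?thesis"
      then have "list_tau (xs n) a \<ge> real k + 1 - C"
        unfolding C_def using xs c k by (intro list_tau_ge) (auto simp: k_def)
      then have "list_tau (xs n) a + C > t * real (Suc n)"
        using k by linarith
      then have "tau (empirical_measure (xs n)) a + C / real (Suc n) > t"
        using tau_empirical_measure[OF ne xs(2)] c xs(1)[of n] by (simp add: divide_simps)
      with elim show False by linarith
    qed
  qed
qed

text \<open>Counterpart of \<open>eventually_ratio_ge\<close>, by contraposition of
  \<open>list_tau_le\<close>.\<close>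

lemma eventually_ratio_le:
  fixes xs :: "nat \<Rightarrow> real list"
  assumes xs: "\<And>n. length (xs n) = Suc n" "\<And>n. \<forall>x\<in>set (xs n). x > 0"
    and conv: "(\<lambda>n. tau (empirical_measure (xs n)) a) \<longlonglongrightarrow> L" and L: "t < L" and t: "0 < t" "t < 1"
    and c: "0 < a" "a < c"
  shows "\<forall>\<^sub>F n in sequentially. esym (xs n) (nat \<lfloor>t * real (Suc n)\<rfloor>) \<le> c * esym (xs n) (Suc (nat \<lfloor>t * real (Suc n)\<rfloor>))"
proof -
  define C where "C = a / (c - a)"
  have "(\<lambda>n. tau (empirical_measure (xs n)) a - C / real (Suc n)) \<longlonglongrightarrow> L - 0"
    by (intro tendsto_diff conv LIMSEQ_Suc[OF lim_const_over_n])
  then have "\<forall>\<^sub>F n in sequentially. tau (empirical_measure (xs n)) a - C / real (Suc n) > t"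
    using L by (intro order_tendstoD) auto
  then show ?thesis
  proof eventually_elim
    case (elim n)
    define k where "k = nat \<lfloor>t * real (Suc n)\<rfloor>"
    have k: "k < Suc n" "real k \<le> t * real (Suc n)"
      using floor_index[OF t, of n] by (auto simp: k_def)
    have ne: "xs n \<noteq> []" using xs(1)[of n] by auto
    show ?case
    proof (rule ccontr)
      assume "\<not> ?thesis"
      then have "list_tau (xs n) a \<le> k + C"
        unfolding C_def using xs c k by (intro list_tau_le) (auto simp: k_def)
      then have "list_tau (xs n) a - C \<le> t * real (Suc n)"
        using k by linarith
      then have "tau (empirical_measure (xs n)) a - C / real (Suc n) \<le> t"
        using tau_empirical_measure[OF ne xs(2), of a] c xs(1)[of n] by (simp add: divide_simps)
      with elim show False by linarith
    qed
  qed
qed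

lemma binomial_Suc_ratio: "Suc k * (Suc n choose Suc k) = (Suc n - k) * (Suc n choose k)"
  using Suc_times_binomial_eq[of n k] binomial_absorb_comp[of "Suc n" k] by (simp add: mult.commute)

text \<open>Splits the room between y and R into one factor c for each of two points. With s = y / R
  the choice c = (1 + s) / 2 works, because c^2 - s = (1 - s)^2 / 4 > 0.\<close>

lemma exists_square_factor:
  fixes y R :: real
  assumes "0 < y" "y < R"
  obtains c where "0 < c" "c < 1" "y < c * c * R"
proof -
  define s where "s = y / R"
  have s: "0 < s" "s < 1" using assms by (auto simp: s_def)
  have "0 < (1 - s)\<^sup>2" using s by simp
  then have "s < ((1 + s) / 2) * ((1 + s) / 2)"
    by (simp add: power2_eq_square field_simps)
  then have "s * R < ((1 + s) / 2) * ((1 + s) / 2) * R"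
    using assms by (intro mult_strict_right_mono) auto
  moreover have "s * R = y"
    using assms by (simp add: s_def)
  ultimately have "y < ((1 + s) / 2) * ((1 + s) / 2) * R"
    by simp
  then show ?thesis
    using assms s by (intro that[of "(1 + s) / 2"]) simp_all
qed

context
  fixes xs ws zs :: "nat \<Rightarrow> real list" and \<mu> \<nu> :: "real measure"
  assumes xs: "\<And>n. length (xs n) = Suc n" "\<And>n. \<forall>x\<in>set (xs n). x > 0"
    and ws: "\<And>n. length (ws n) = Suc n" "\<And>n. \<forall>x\<in>set (ws n). x > 0"
    and zs: "\<And>n. length (zs n) = Suc n" "\<And>n. \<forall>x\<in>set (zs n). x > 0"
    and esym_zs: "\<And>n k. k \<le> Suc n \<Longrightarrow> esym (zs n) k * real (Suc n choose k) = esym (xs n) k * esym (ws n) k"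
    and conv_xs: "\<And>y. y > 0 \<Longrightarrow> (\<lambda>n. tau (empirical_measure (xs n)) y) \<longlonglongrightarrow> tau \<mu> y"
    and conv_ws: "\<And>y. y > 0 \<Longrightarrow> (\<lambda>n. tau (empirical_measure (ws n)) y) \<longlonglongrightarrow> tau \<nu> y"
begin

lemma zs_ne: "zs n \<noteq> []"
  using zs(1)[of n] by auto

text \<open>Cross-multiplied form of the rule that the ratio e(k) / e(k + 1) for \<open>zs\<close>
  is the product of those for \<open>xs\<close> and \<open>ws\<close> times (n + 1 - k) / (k + 1),
  the quotient of consecutive binomial coefficients.\<close>

lemma esym_zs_ratio:
  assumes "k < Suc n"
  shows "esym (zs n) k * (esym (xs n) (Suc k) * esym (ws n) (Suc k)) * real (k + 1) =
         esym (zs n) (Suc k) * (esym (xs n) k * esym (ws n) k) * real (Suc n - k)"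
proof -
  have 1: "real (Suc k) * real (Suc n choose Suc k) = real (Suc n - k) * real (Suc n choose k)"
    by (metis binomial_Suc_ratio of_nat_mult)
  have 2: "esym (xs n) (Suc k) * esym (ws n) (Suc k) = esym (zs n) (Suc k) * real (Suc n choose Suc k)"
     "esym (xs n) k * esym (ws n) k = esym (zs n) k * real (Suc n choose k)"
    using esym_zs[of "Suc k" n] esym_zs[of k n] assms by auto
  have "esym (zs n) k * (esym (zs n) (Suc k) * real (Suc n choose Suc k)) * real (k + 1) =
      esym (zs n) k * esym (zs n) (Suc k) * (real (Suc k) * real (Suc n choose Suc k))"
    by simp
  also have "\<dots> = esym (zs n) (Suc k) * (esym (zs n) k * real (Suc n choose k)) * real (Suc n - k)"
    unfolding 1 by (simp only: mult_ac)
  finally show ?thesis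
    unfolding 2 .
qed

text \<open>At the index k = floor(t (n + 1)) the ratios of \<open>xs\<close> and \<open>ws\<close>
  eventually exceed numbers slightly below a and b. The ratio of \<open>zs\<close> then exceeds some
  y' > y, and \<open>list_tau_le\<close> bounds the transform at y.\<close>

lemma eventually_tau_zs_less:
  assumes t: "0 < t" "t < 1" and ab: "a > 0" "b > 0" "tau \<mu> a < t" "tau \<nu> b < t"
    and y: "0 < y" "y < a * b * ((1 - t) / t)" and "\<epsilon> > 0"
  shows "\<forall>\<^sub>F n in sequentially. tau (empirical_measure (zs n)) y < t + \<epsilon>"
proof -
  \<comment> \<open>Three strict gaps are needed: from a to a' and from b to b' for the ratio
    lemmas, and from y to y' for the error term C of \<open>list_tau_le\<close>.\<close>
  obtain c where c: "0 < c" "c < 1" "y < c * c * (a * b * ((1 - t) / t))"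
    using exists_square_factor[OF y] .
  define a' where "a' = c * a"
  define b' where "b' = c * b"
  have a': "0 < a'" "a' < a" and b': "0 < b'" "b' < b"
    using c ab by (auto simp: a'_def b'_def)
  have "y < a' * b' * ((1 - t) / t)"
    using c by (simp add: a'_def b'_def mult_ac)
  then obtain y' where y': "y < y'" "y' < a' * b' * ((1 - t) / t)"
    using dense by blast
  define C where "C = y / (y' - y)"
  \<comment> \<open>The fraction is a lower bound, free of the floor, for (n + 1 - k) / (k + 1); it
    comes from k \<le> t (n + 1).\<close>
  have "(\<lambda>n. a' * b' * (((1 - t) * real (Suc n)) / (t * real (Suc n) + 1))) \<longlonglongrightarrow> a' * b' * ((1 - t) / t)"
  proof (intro tendsto_mult tendsto_const)
    have "(\<lambda>n. ((1 - t) * real (Suc n)) / (t * real (Suc n) + 1)) \<longlonglongrightarrow> (1 - t) * inverse t"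
      using t by real_asymp
    then show "(\<lambda>n. ((1 - t) * real (Suc n)) / (t * real (Suc n) + 1)) \<longlonglongrightarrow> (1 - t) / t"
      by (simp only: divide_inverse)
  qed
  then have ev1: "\<forall>\<^sub>F n in sequentially. a' * b' * (((1 - t) * real (Suc n)) / (t * real (Suc n) + 1)) > y'"
    using y' by (intro order_tendstoD) auto
  have "(\<lambda>n. C / real (Suc n)) \<longlonglongrightarrow> 0"
    by (intro LIMSEQ_Suc[OF lim_const_over_n])
  then have ev2: "\<forall>\<^sub>F n in sequentially. C / real (Suc n) < \<epsilon>"
    using \<open>\<epsilon> > 0\<close> by (intro order_tendstoD) auto
  show ?thesis
    using ev1 ev2
      eventually_ratio_ge[OF xs conv_xs[OF ab(1)] ab(3) t a']
      eventually_ratio_ge[OF ws conv_ws[OF ab(2)] ab(4) t b']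
  proof eventually_elim
    case (elim n)
    define k where "k = nat \<lfloor>t * real (Suc n)\<rfloor>"
    have k: "k < Suc n" "real k \<le> t * real (Suc n)"
      using floor_index[OF t, of n] by (auto simp: k_def)
    have pos: "esym (xs n) (Suc k) * esym (ws n) (Suc k) > 0"
      using esym_pos xs ws k by (intro mult_pos_pos) auto
    have zn: "esym (zs n) (Suc k) \<ge> 0" using esym_nonneg zs by blast
    have le: "a' * esym (xs n) (Suc k) * (b' * esym (ws n) (Suc k)) \<le> esym (xs n) k * esym (ws n) k"
      using elim(3,4) a' b' esym_nonneg[OF xs(2)] esym_nonneg[OF ws(2)]
      by (intro mult_mono) (auto simp: k_def)
    have "((1 - t) * real (Suc n)) / (t * real (Suc n) + 1) \<le> real (Suc n - k) / real (k + 1)"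
      using k t by (intro frac_le) (auto simp: algebra_simps of_nat_diff)
    then have "a' * b' * (((1 - t) * real (Suc n)) / (t * real (Suc n) + 1)) \<le> a' * b' * (real (Suc n - k) / real (k + 1))"
      using a' b' by (intro mult_left_mono) auto
    with elim(1) have q: "y' \<le> a' * b' * (real (Suc n - k) / real (k + 1))"
      by linarith
    then have "y' * real (k + 1) \<le> a' * b' * real (Suc n - k)"
      by (simp add: field_simps)
    then have "y' * real (k + 1) * (esym (zs n) (Suc k) * (esym (xs n) (Suc k) * esym (ws n) (Suc k)))
       \<le> a' * b' * real (Suc n - k) * (esym (zs n) (Suc k) * (esym (xs n) (Suc k) * esym (ws n) (Suc k)))"
      using pos zn by (intro mult_right_mono) auto
    also have "\<dots> = esym (zs n) (Suc k) * real (Suc n - k) * (a' * esym (xs n) (Suc k) * (b' * esym (ws n) (Suc k)))"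
      by (simp add: mult_ac)
    also have "\<dots> \<le> esym (zs n) (Suc k) * real (Suc n - k) * (esym (xs n) k * esym (ws n) k)"
      using le zn by (intro mult_left_mono) auto
    also have "\<dots> = esym (zs n) k * (esym (xs n) (Suc k) * esym (ws n) (Suc k)) * real (k + 1)"
      using esym_zs_ratio[OF k(1)] by (simp add: mult_ac)
    finally have "(y' * esym (zs n) (Suc k)) * ((esym (xs n) (Suc k) * esym (ws n) (Suc k)) * real (k + 1))
       \<le> esym (zs n) k * ((esym (xs n) (Suc k) * esym (ws n) (Suc k)) * real (k + 1))"
      by (simp only: mult_ac)
    moreover have "0 < (esym (xs n) (Suc k) * esym (ws n) (Suc k)) * real (k + 1)"
      using pos by (intro mult_pos_pos[OF pos]) auto
    ultimately have "y' * esym (zs n) (Suc k) \<le> esym (zs n) k"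
      by (simp only: mult_le_cancel_right_pos)
    then have "list_tau (zs n) y \<le> k + C"
      unfolding C_def using y y' k zs by (intro list_tau_le) auto
    then have "list_tau (zs n) y \<le> t * real (Suc n) + C"
      using k by linarith
    then have "tau (empirical_measure (zs n)) y \<le> t + C / real (Suc n)"
      using tau_empirical_measure[OF zs_ne[of n] zs(2)[of n], of y] zs(1)[of n] y by (simp add: divide_simps)
    then show ?case
      using elim(2) by linarith
  qed
qed

text \<open>The opposite bound, with a and b enlarged and \<open>list_tau_ge\<close> in place of
  \<open>list_tau_le\<close>. Now t (n + 1) < k + 1 gives the upper bound for the binomial
  factor.\<close>

lemma eventually_tau_zs_greater:
  assumes t: "0 < t" "t < 1" and ab: "a > 0" "b > 0" "tau \<mu> a > t" "tau \<nu> b > t"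
    and y: "a * b * ((1 - t) / t) < y" and "\<epsilon> > 0"
  shows "\<forall>\<^sub>F n in sequentially. tau (empirical_measure (zs n)) y > t - \<epsilon>"
proof -
  have R: "0 < a * b * ((1 - t) / t)"
    using t ab by simp
  obtain c where c: "0 < c" "c < 1" "a * b * ((1 - t) / t) < c * c * y"
    using exists_square_factor[OF R y] .
  define a' where "a' = a / c"
  define b' where "b' = b / c"
  have a': "0 < a" "a < a'" and b': "0 < b" "b < b'"
    using c ab by (auto simp: a'_def b'_def field_simps)
  have "a' * b' * ((1 - t) / t) < y"
    using c t by (simp add: a'_def b'_def field_simps)
  then obtain y' where y': "y' < y" "a' * b' * ((1 - t) / t) < y'"
    using dense by blast
  have y'pos: "0 < y'"
    using y'(2) a' b' t by (smt (verit) divide_pos_pos mult_pos_pos)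
  define C where "C = y' / (y - y')"
  have "(\<lambda>n. a' * b' * (((1 - t) * real (Suc n) + 1) / (t * real (Suc n)))) \<longlonglongrightarrow> a' * b' * ((1 - t) / t)"
  proof (intro tendsto_mult tendsto_const)
    have "(\<lambda>n. ((1 - t) * real (Suc n) + 1) / (t * real (Suc n))) \<longlonglongrightarrow> (1 - t) * inverse t"
      using t by real_asymp
    then show "(\<lambda>n. ((1 - t) * real (Suc n) + 1) / (t * real (Suc n))) \<longlonglongrightarrow> (1 - t) / t"
      by (simp only: divide_inverse)
  qed
  then have ev1: "\<forall>\<^sub>F n in sequentially. a' * b' * (((1 - t) * real (Suc n) + 1) / (t * real (Suc n))) < y'"
    using y' by (intro order_tendstoD) auto
  have "(\<lambda>n. C / real (Suc n)) \<longlonglongrightarrow> 0"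
    by (intro LIMSEQ_Suc[OF lim_const_over_n])
  then have ev2: "\<forall>\<^sub>F n in sequentially. C / real (Suc n) < \<epsilon>"
    using \<open>\<epsilon> > 0\<close> by (intro order_tendstoD) auto
  show ?thesis
    using ev1 ev2
      eventually_ratio_le[OF xs conv_xs[OF ab(1)] ab(3) t a']
      eventually_ratio_le[OF ws conv_ws[OF ab(2)] ab(4) t b']
  proof eventually_elim
    case (elim n)
    define k where "k = nat \<lfloor>t * real (Suc n)\<rfloor>"
    have k: "k < Suc n" "t * real (Suc n) < real k + 1"
      using floor_index[OF t, of n] by (auto simp: k_def)
    have pos: "esym (xs n) (Suc k) * esym (ws n) (Suc k) > 0"
      using esym_pos xs ws k by (intro mult_pos_pos) auto
    have zn: "esym (zs n) (Suc k) \<ge> 0" using esym_nonneg zs by blast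
    have le: "esym (xs n) k * esym (ws n) k \<le> a' * esym (xs n) (Suc k) * (b' * esym (ws n) (Suc k))"
      using elim(3,4) a' b' esym_nonneg[OF xs(2)] esym_nonneg[OF ws(2)]
      by (intro mult_mono) (auto simp: k_def)
    have tpos: "0 < t * real (Suc n)" using t by simp
    have "real (Suc n - k) / real (k + 1) \<le> ((1 - t) * real (Suc n) + 1) / (t * real (Suc n))"
    proof (rule frac_le)
      have "real (Suc n - k) = real (Suc n) - real k"
        using k by (intro of_nat_diff) auto
      also have "\<dots> \<le> (1 - t) * real (Suc n) + 1"
        using k by (simp add: algebra_simps)
      finally show "real (Suc n - k) \<le> (1 - t) * real (Suc n) + 1" .
    qed (use k tpos t in auto)
    then have "a' * b' * (real (Suc n - k) / real (k + 1)) \<le> a' * b' * (((1 - t) * real (Suc n) + 1) / (t * real (Suc n)))"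
      using a' b' by (intro mult_left_mono) auto
    with elim(1) have q: "a' * b' * (real (Suc n - k) / real (k + 1)) \<le> y'"
      by linarith
    then have "a' * b' * real (Suc n - k) \<le> y' * real (k + 1)"
      by (simp add: field_simps)
    have "esym (zs n) k * ((esym (xs n) (Suc k) * esym (ws n) (Suc k)) * real (k + 1))
        = esym (zs n) (Suc k) * real (Suc n - k) * (esym (xs n) k * esym (ws n) k)"
      using esym_zs_ratio[OF k(1)] by (simp add: mult_ac)
    also have "\<dots> \<le> esym (zs n) (Suc k) * real (Suc n - k) * (a' * esym (xs n) (Suc k) * (b' * esym (ws n) (Suc k)))"
      using le zn by (intro mult_left_mono) auto
    also have "\<dots> = a' * b' * real (Suc n - k) * (esym (zs n) (Suc k) * (esym (xs n) (Suc k) * esym (ws n) (Suc k)))"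
      by (simp add: mult_ac)
    also have "\<dots> \<le> y' * real (k + 1) * (esym (zs n) (Suc k) * (esym (xs n) (Suc k) * esym (ws n) (Suc k)))"
      using pos zn \<open>a' * b' * real (Suc n - k) \<le> y' * real (k + 1)\<close> by (intro mult_right_mono) auto
    finally have "esym (zs n) k * ((esym (xs n) (Suc k) * esym (ws n) (Suc k)) * real (k + 1))
       \<le> (y' * esym (zs n) (Suc k)) * ((esym (xs n) (Suc k) * esym (ws n) (Suc k)) * real (k + 1))"
      by (simp only: mult_ac)
    moreover have "0 < (esym (xs n) (Suc k) * esym (ws n) (Suc k)) * real (k + 1)"
      using pos by (intro mult_pos_pos[OF pos]) auto
    ultimately have "esym (zs n) k \<le> y' * esym (zs n) (Suc k)"
      by (simp only: mult_le_cancel_right_pos)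
    then have "list_tau (zs n) y \<ge> real k + 1 - C"
      unfolding C_def using y'pos y' k zs by (intro list_tau_ge) auto
    then have "list_tau (zs n) y \<ge> t * real (Suc n) - C"
      using k by linarith
    then have "tau (empirical_measure (zs n)) y \<ge> t - C / real (Suc n)"
      using tau_empirical_measure[OF zs_ne[of n] zs(2)[of n], of y] zs(1)[of n] y'pos y' by (simp add: divide_simps)
    then show ?case
      using elim(2) by linarith
  qed
qed

end

section \<open>Construction of the limit measure and its identification with the free
  product\<close>

text \<open>The bound \<open>less\<close> at small t makes the empirical measures of
  \<open>zs\<close> tight, and \<rho> is a subsequential weak limit. The two one-sided conclusions
  together give the product formula when both transforms equal t; separately they also apply when it
  is not yet known that a factor attains t.\<close>

theorem free_product_exists:
  assumes \<mu>: "prob_nonneg \<mu>" "\<mu> \<noteq> delta0" and \<nu>: "prob_nonneg \<nu>" "\<nu> \<noteq> delta0"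
  obtains \<rho> where "prob_nonneg \<rho>"
    and "\<And>t a b. 0 < t \<Longrightarrow> t < 1 \<Longrightarrow> 0 < a \<Longrightarrow> 0 < b \<Longrightarrow> tau \<mu> a \<le> t \<Longrightarrow> tau \<nu> b \<le> t \<Longrightarrow> tau \<rho> (a * b * ((1 - t) / t)) \<le> t"
    and "\<And>t a b. 0 < t \<Longrightarrow> t < 1 \<Longrightarrow> 0 < a \<Longrightarrow> 0 < b \<Longrightarrow> t \<le> tau \<mu> a \<Longrightarrow> t \<le> tau \<nu> b \<Longrightarrow> t \<le> tau \<rho> (a * b * ((1 - t) / t))"
proof -
  have rd: "real_distribution \<mu>" "real_distribution \<nu>"
    using \<mu> \<nu> by (auto intro: prob_nonnegD)
  obtain xs where xs: "\<And>n. length (xs n) = Suc n" "\<And>n. \<forall>x\<in>set (xs n). x > 0"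
    "\<And>y. y > 0 \<Longrightarrow> (\<lambda>n. tau (empirical_measure (xs n)) y) \<longlonglongrightarrow> tau \<mu> y"
    using empirical_approximation[OF rd(1)] by metis
  obtain ws where ws: "\<And>n. length (ws n) = Suc n" "\<And>n. \<forall>x\<in>set (ws n). x > 0"
    "\<And>y. y > 0 \<Longrightarrow> (\<lambda>n. tau (empirical_measure (ws n)) y) \<longlonglongrightarrow> tau \<nu> y"
    using empirical_approximation[OF rd(2)] by metis
  have "\<exists>z. length z = Suc n \<and> (\<forall>x\<in>set z. x > 0) \<and>
      (\<forall>k\<le>Suc n. esym z k * real (Suc n choose k) = esym (xs n) k * esym (ws n) k)" for n
    by (rule finite_free_product) (use xs ws in auto)
  then obtain zs where zs: "\<And>n. length (zs n) = Suc n" "\<And>n. \<forall>x\<in>set (zs n). x > 0"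
    "\<And>n k. k \<le> Suc n \<Longrightarrow> esym (zs n) k * real (Suc n choose k) = esym (xs n) k * esym (ws n) k"
    by metis
  have less: "\<forall>\<^sub>F n in sequentially. tau (empirical_measure (zs n)) y < t + \<epsilon>"
    if "0 < t" "t < 1" "0 < a" "0 < b" "tau \<mu> a < t" "tau \<nu> b < t" "0 < y" "y < a * b * ((1 - t) / t)" "0 < \<epsilon>"
    for t a b y \<epsilon>
    by (rule eventually_tau_zs_less[of xs ws zs \<mu> \<nu> t a b y \<epsilon>]; fact xs ws zs that)
  have greater: "\<forall>\<^sub>F n in sequentially. t - \<epsilon> < tau (empirical_measure (zs n)) y"
    if "0 < t" "t < 1" "0 < a" "0 < b" "t < tau \<mu> a" "t < tau \<nu> b" "a * b * ((1 - t) / t) < y" "0 < \<epsilon>"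
    for t a b y \<epsilon>
    by (rule eventually_tau_zs_greater[of xs ws zs \<mu> \<nu> t a b y \<epsilon>]; fact xs ws zs that)
  have emp: "prob_nonneg (empirical_measure (zs n))" for n
    using zs(1)[of n] zs(2)[of n] by (intro prob_nonneg_empirical_measure) (auto intro: less_imp_le)
  have "tight (\<lambda>n. empirical_measure (zs n))"
  proof (rule tight_if_tau[OF emp])
    fix \<epsilon> :: real assume "\<epsilon> > 0"
    \<comment> \<open>One half of \<epsilon> is spent on t and the other on the error in
      \<open>less\<close>; the cap 1 / 2 ensures t < 1.\<close>
    define t where "t = min (\<epsilon> / 2) (1 / 2)"
    have t: "0 < t" "t < 1" "t + \<epsilon> / 2 \<le> \<epsilon>"
      using \<open>\<epsilon> > 0\<close> by (auto simp: t_def)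
    obtain a where a: "a > 0" "tau \<mu> a < t" using tau_small[OF rd(1) t(1)] .
    obtain b where b: "b > 0" "tau \<nu> b < t" using tau_small[OF rd(2) t(1)] .
    have R: "0 < a * b * ((1 - t) / t)"
      using a b t by simp
    then obtain y where y: "0 < y" "y < a * b * ((1 - t) / t)"
      using dense by blast
    have "\<forall>\<^sub>F n in sequentially. tau (empirical_measure (zs n)) y < t + \<epsilon> / 2"
      using less[OF t(1,2) a(1) b(1) a(2) b(2) y, of "\<epsilon> / 2"] \<open>\<epsilon> > 0\<close> by simp
    then have "\<forall>\<^sub>F n in sequentially. tau (empirical_measure (zs n)) y < \<epsilon>"
      by eventually_elim (use t in linarith)
    then show "\<exists>y>0. \<forall>\<^sub>F n in sequentially. tau (empirical_measure (zs n)) y < \<epsilon>"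
      using y by blast
  qed
  from tight_imp_convergent_subsubsequence[OF this, of id]
  obtain r \<rho> where r: "strict_mono r" and \<rho>: "real_distribution \<rho>" and "weak_conv_m ((\<lambda>n. empirical_measure (zs n)) \<circ> id \<circ> r) \<rho>"
    by (auto simp: strict_mono_def)
  then have wc: "weak_conv_m (\<lambda>n. empirical_measure (zs (r n))) \<rho>"
    by (simp add: o_def)
  have conv: "(\<lambda>n. tau (empirical_measure (zs (r n))) y) \<longlonglongrightarrow> tau \<rho> y" if "y > 0" for y
    using that by (intro tau_weak_conv real_distribution_empirical_measure \<rho> wc) auto
  have up: "tau \<rho> y \<le> t"
    if t: "0 < t" "t < 1" and ab: "0 < a" "0 < b" "tau \<mu> a \<le> t" "tau \<nu> b \<le> t" and y: "0 < y" "y < a * b * ((1 - t) / t)" for t a b y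
  proof -
    \<comment> \<open>Scaling both points by c makes the inequalities against t strict by
      \<open>tau_strict_mono\<close>, while y stays below the product of the scaled points.\<close>
    obtain c where c: "0 < c" "c < 1" "y < c * c * (a * b * ((1 - t) / t))"
      using exists_square_factor[OF y] .
    have "tau \<mu> (c * a) < tau \<mu> a" "tau \<nu> (c * b) < tau \<nu> b"
      using c ab by (intro tau_strict_mono \<mu> \<nu>; simp)+
    then have ca: "tau \<mu> (c * a) < t" "tau \<nu> (c * b) < t"
      using ab by linarith+
    have yc: "y < (c * a) * (c * b) * ((1 - t) / t)"
      using c by (simp add: mult_ac)
    have pos: "0 < c * a" "0 < c * b"
      using c ab by simp_all
    show ?thesis
    proof (rule field_le_epsilon)
      fix \<epsilon> :: real assume "\<epsilon> > 0"
      have "\<forall>\<^sub>F n in sequentially. tau (empirical_measure (zs (r n))) y < t + \<epsilon>"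
        using eventually_subseq[OF r less[OF t pos ca y(1) yc \<open>\<epsilon> > 0\<close>]] .
      then show "tau \<rho> y \<le> t + \<epsilon>"
        by (intro tendsto_upperbound[OF conv[OF y(1)]]) (auto elim: eventually_mono)
    qed
  qed
  have low: "t \<le> tau \<rho> y"
    if t: "0 < t" "t < 1" and ab: "0 < a" "0 < b" "t \<le> tau \<mu> a" "t \<le> tau \<nu> b" and y: "a * b * ((1 - t) / t) < y" for t a b y
  proof -
    have R: "0 < a * b * ((1 - t) / t)"
      using t ab by simp
    obtain c where c: "0 < c" "c < 1" "a * b * ((1 - t) / t) < c * c * y"
      using exists_square_factor[OF R y] .
    have ac: "a < a / c" "b < b / c"
      using c ab by (simp_all add: field_simps)
    have "tau \<mu> a < tau \<mu> (a / c)" "tau \<nu> b < tau \<nu> (b / c)"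
      using ac ab by (intro tau_strict_mono \<mu> \<nu>; simp)+
    then have ca: "t < tau \<mu> (a / c)" "t < tau \<nu> (b / c)"
      using ab by linarith+
    have yc: "(a / c) * (b / c) * ((1 - t) / t) < y"
    proof -
      have "(a / c) * (b / c) * ((1 - t) / t) = (a * b * ((1 - t) / t)) / (c * c)"
        by simp
      also have "\<dots> < y"
        using c by (subst pos_divide_less_eq) (auto simp: mult.commute)
      finally show ?thesis .
    qed
    have pos: "0 < a / c" "0 < b / c"
      using c ab by simp_all
    show ?thesis
    proof (rule field_le_epsilon)
      fix \<epsilon> :: real assume "\<epsilon> > 0"
      have "\<forall>\<^sub>F n in sequentially. t - \<epsilon> < tau (empirical_measure (zs (r n))) y"
        using eventually_subseq[OF r greater[OF t pos ca yc \<open>\<epsilon> > 0\<close>]] .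
      then have "t - \<epsilon> \<le> tau \<rho> y"
        using R y by (intro tendsto_lowerbound[OF conv]) (auto elim: eventually_mono)
      then show "t \<le> tau \<rho> y + \<epsilon>" by simp
    qed
  qed
  show ?thesis
  proof (rule that[of \<rho>])
    show "prob_nonneg \<rho>"
      using prob_nonneg_weak_limit[OF emp \<rho> wc] .
    fix t a b :: real
    assume t: "0 < t" "t < 1" and ab: "0 < a" "0 < b"
    define R where "R = a * b * ((1 - t) / t)"
    have R: "R > 0" using t ab by (simp add: R_def)
    show "tau \<rho> R \<le> t" if "tau \<mu> a \<le> t" "tau \<nu> b \<le> t" unfolding R_def[symmetric]
    proof (rule field_le_epsilon)
      fix \<epsilon> :: real assume "\<epsilon> > 0"
      \<comment> \<open>Chosen so that the Lipschitz bound of \<open>tau_diff_le\<close> between y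
        and R is exactly \<epsilon>; this carries the estimate from y < R to R itself.\<close>
      define y where "y = R / (1 + \<epsilon>)"
      have y0: "0 < y" and Ry: "R = y * (1 + \<epsilon>)"
        using R \<open>\<epsilon> > 0\<close> by (simp_all add: y_def)
      have y: "0 < y" "y < R" "(R - y) / y = \<epsilon>"
        using y0 \<open>\<epsilon> > 0\<close> unfolding Ry by (simp_all add: distrib_left)
      have "tau \<rho> y \<le> t"
        using up[OF t ab that y(1)] y(2) by (simp add: R_def)
      then show "tau \<rho> R \<le> t + \<epsilon>"
        using tau_diff_le[OF \<rho> y(1), of R] y by simp
    qed
    show "t \<le> tau \<rho> R" if "t \<le> tau \<mu> a" "t \<le> tau \<nu> b" unfolding R_def[symmetric]
    proof (rule field_le_epsilon)
      fix \<epsilon> :: real assume "\<epsilon> > 0"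
      define y where "y = R * (1 + \<epsilon>)"
      have y: "R < y" "(y - R) / R = \<epsilon>"
        using R \<open>\<epsilon> > 0\<close> by (simp_all add: y_def distrib_left)
      have "t \<le> tau \<rho> y"
        using low[OF t ab that] y(1) by (simp add: R_def)
      then show "t \<le> tau \<rho> R + \<epsilon>"
        using tau_diff_le[OF \<rho> R, of y] y by simp
    qed
  qed
qed

text \<open>The limit measure satisfies the defining S-transform equation. Any other solution has
  the same S-transform near 0, hence the same \<open>tau\<close> near 0, and equals it by
  \<open>tau_determines\<close>. So the definite description denotes the limit measure.\<close>

theorem tau_boxtimes:
  assumes \<mu>: "prob_nonneg \<mu>" "\<mu> \<noteq> delta0" and \<nu>: "prob_nonneg \<nu>" "\<nu> \<noteq> delta0"
    and t: "0 < t" "t < 1" and ab: "0 < a" "0 < b"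
  shows "tau \<mu> a \<le> t \<Longrightarrow> tau \<nu> b \<le> t \<Longrightarrow> tau (boxtimes \<mu> \<nu>) (a * b * ((1 - t) / t)) \<le> t"
    and "t \<le> tau \<mu> a \<Longrightarrow> t \<le> tau \<nu> b \<Longrightarrow> t \<le> tau (boxtimes \<mu> \<nu>) (a * b * ((1 - t) / t))"
proof -
  have rd: "real_distribution \<mu>" "real_distribution \<nu>"
    using \<mu> \<nu> by (auto intro: prob_nonnegD)
  obtain \<rho> where \<rho>: "prob_nonneg \<rho>"
    and le: "\<And>t a b. 0 < t \<Longrightarrow> t < 1 \<Longrightarrow> 0 < a \<Longrightarrow> 0 < b \<Longrightarrow> tau \<mu> a \<le> t \<Longrightarrow> tau \<nu> b \<le> t \<Longrightarrow> tau \<rho> (a * b * ((1 - t) / t)) \<le> t"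
    and ge: "\<And>t a b. 0 < t \<Longrightarrow> t < 1 \<Longrightarrow> 0 < a \<Longrightarrow> 0 < b \<Longrightarrow> t \<le> tau \<mu> a \<Longrightarrow> t \<le> tau \<nu> b \<Longrightarrow> t \<le> tau \<rho> (a * b * ((1 - t) / t))"
    using free_product_exists[OF \<mu> \<nu>] by blast
  \<comment> \<open>All levels up to this one are attained by both transforms at points of the
    interval from 0 to 1.\<close>
  define \<epsilon> where "\<epsilon> = min (tau \<mu> 1) (tau \<nu> 1)"
  have \<epsilon>: "0 < \<epsilon>" "\<epsilon> < 1" "\<epsilon> \<le> tau \<mu> 1" "\<epsilon> \<le> tau \<nu> 1"
    using tau_pos[OF \<mu>, of 1] tau_pos[OF \<nu>, of 1] tau_less_1[OF rd(1), of 1] by (auto simp: \<epsilon>_def)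
  have "\<rho> \<noteq> delta0"
    using ge[of \<epsilon> 1 1] \<epsilon> tau_delta0[of "(1 - \<epsilon>) / \<epsilon>"] by auto
  note \<rho> = \<rho> this
  have S: "S_tr \<rho> z = S_tr \<mu> z * S_tr \<nu> z" if z: "z \<in> {-\<epsilon><..<0}" for z
  proof -
    define t where "t = - z"
    have t: "0 < t" "t < 1" "t \<le> tau \<mu> 1" "t \<le> tau \<nu> 1"
      using z \<epsilon> by (auto simp: t_def)
    obtain a where a: "0 < a" "tau \<mu> a = t"
      using tau_attains[OF rd(1) t(1,3)] by auto
    obtain b where b: "0 < b" "tau \<nu> b = t"
      using tau_attains[OF rd(2) t(1,4)] by auto
    define R where "R = a * b * ((1 - t) / t)"
    have R: "R > 0" "tau \<rho> R = t"
      using t a b le[OF t(1,2) a(1) b(1)] ge[OF t(1,2) a(1) b(1)] by (auto simp: R_def)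
    have "S_tr \<rho> (- t) = R * (1 - t) / t" "S_tr \<mu> (- t) = a * (1 - t) / t" "S_tr \<nu> (- t) = b * (1 - t) / t"
      using S_tr_eq[OF \<rho> R(1)] S_tr_eq[OF \<mu> a(1)] S_tr_eq[OF \<nu> b(1)] R a b by simp_all
    then show ?thesis
      by (simp add: t_def[symmetric] R_def) (simp add: t_def)
  qed
  have "boxtimes \<mu> \<nu> = \<rho>"
  proof -
    have "(THE \<rho>. prob_nonneg \<rho> \<and> \<rho> \<noteq> delta0 \<and>
              (\<exists>\<epsilon>>0. \<forall>z\<in>{-\<epsilon><..<0}. S_tr \<rho> z = S_tr \<mu> z * S_tr \<nu> z)) = \<rho>"
    proof (rule the_equality)
      show "prob_nonneg \<rho> \<and> \<rho> \<noteq> delta0 \<and> (\<exists>\<epsilon>>0. \<forall>z\<in>{-\<epsilon><..<0}. S_tr \<rho> z = S_tr \<mu> z * S_tr \<nu> z)"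
        using \<rho> S \<epsilon>(1) by blast
      fix \<rho>'
      assume "prob_nonneg \<rho>' \<and> \<rho>' \<noteq> delta0 \<and> (\<exists>\<epsilon>>0. \<forall>z\<in>{-\<epsilon><..<0}. S_tr \<rho>' z = S_tr \<mu> z * S_tr \<nu> z)"
      then obtain \<epsilon>' where \<rho>': "prob_nonneg \<rho>'" "\<rho>' \<noteq> delta0" and \<epsilon>': "\<epsilon>' > 0"
         and S': "\<And>z. z \<in> {-\<epsilon>'<..<0} \<Longrightarrow> S_tr \<rho>' z = S_tr \<mu> z * S_tr \<nu> z"
        by blast
      have rd: "real_distribution \<rho>" "real_distribution \<rho>'"
        using \<rho> \<rho>' by (auto intro: prob_nonnegD)
      have "0 < min (min \<epsilon> \<epsilon>') (tau \<rho>' 1)"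
        using \<epsilon> \<epsilon>' tau_pos[OF \<rho>', of 1] by simp
      \<comment> \<open>For y < \<delta> the level \<open>tau \<rho> y\<close> is small enough for
        both S-transform equations to apply and for \<rho>' to attain it.\<close>
      then obtain \<delta> where \<delta>: "\<delta> > 0" "tau \<rho> \<delta> < min (min \<epsilon> \<epsilon>') (tau \<rho>' 1)"
        using tau_small[OF rd(1)] by blast
      show "\<rho>' = \<rho>"
      proof (rule tau_determines[OF \<rho>'(1) \<rho>(1) \<delta>(1)])
        fix y assume y: "0 < y" "y < \<delta>"
        define t where "t = tau \<rho> y"
        have "t \<le> tau \<rho> \<delta>"
          unfolding t_def using y by (intro tau_mono rd) auto
        then have t: "0 < t" "t < \<epsilon>" "t < \<epsilon>'" "t \<le> tau \<rho>' 1" "t < 1"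
          using \<delta> tau_pos[OF \<rho> y(1)] \<epsilon> by (auto simp: t_def)
        obtain y' where y': "0 < y'" "tau \<rho>' y' = t"
          using tau_attains[OF rd(2) t(1,4)] by auto
        have "S_tr \<rho> (- t) = S_tr \<rho>' (- t)"
          using t S[of "- t"] S'[of "- t"] by simp
        then have "y * (1 - t) / t = y' * (1 - t) / t"
          using S_tr_eq[OF \<rho> y(1)] S_tr_eq[OF \<rho>' y'(1)] y' by (simp add: t_def)
        then have "y = y'"
          using t by simp
        then show "tau \<rho>' y = tau \<rho> y"
          using y' by (simp add: t_def)
      qed
    qed
    then show ?thesis
      using \<mu> \<nu> by (simp add: boxtimes_def)
  qed
  then show "tau \<mu> a \<le> t \<Longrightarrow> tau \<nu> b \<le> t \<Longrightarrow> tau (boxtimes \<mu> \<nu>) (a * b * ((1 - t) / t)) \<le> t"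
    and "t \<le> tau \<mu> a \<Longrightarrow> t \<le> tau \<nu> b \<Longrightarrow> t \<le> tau (boxtimes \<mu> \<nu>) (a * b * ((1 - t) / t))"
    using le ge t ab by auto
qed

section \<open>Normalised decompositions\<close>

text \<open>Pick a point where one factor is below t and the complementary point for which the
  product formula lands at y. If the other factor were at most t there, the product would be at most
  t at y. So it exceeds t, and \<open>tau_attains\<close> applies.\<close>

lemma tau_factor_attains:
  assumes \<mu>: "prob_nonneg \<mu>" "\<mu> \<noteq> delta0" and \<nu>: "prob_nonneg \<nu>" "\<nu> \<noteq> delta0"
    and y: "0 < y" and t: "0 < t" "t < tau (boxtimes \<mu> \<nu>) y" "t < 1"
  shows "\<exists>a>0. tau \<mu> a = t" and "\<exists>b>0. tau \<nu> b = t"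
proof -
  have rd: "real_distribution \<mu>" "real_distribution \<nu>"
    using \<mu> \<nu> by (auto intro: prob_nonnegD)
  have bound: "\<not> (tau \<mu> a \<le> t \<and> tau \<nu> b \<le> t)" if "0 < a" "0 < b" "a * b * ((1 - t) / t) = y" for a b
    using tau_boxtimes(1)[OF \<mu> \<nu> t(1,3) that(1,2)] that(3) t by auto
  have pos: "(1 - t) / t > 0" using t by simp
  show "\<exists>a>0. tau \<mu> a = t"
  proof -
    obtain b where b: "b > 0" "tau \<nu> b < t" using tau_small[OF rd(2) t(1)] .
    define a where "a = y / (b * ((1 - t) / t))"
    have a: "a > 0" "a * b * ((1 - t) / t) = y"
      using y b pos t by (auto simp: a_def)
    then have "t \<le> tau \<mu> a"
      using bound[of a b] b by auto
    then show ?thesis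
      using tau_attains[OF rd(1) t(1) _ a(1)] by metis
  qed
  show "\<exists>b>0. tau \<nu> b = t"
  proof -
    obtain a where a: "a > 0" "tau \<mu> a < t" using tau_small[OF rd(1) t(1)] .
    define b where "b = y / (a * ((1 - t) / t))"
    have b: "b > 0" "a * b * ((1 - t) / t) = y"
      using y a pos t by (auto simp: b_def)
    then have "t \<le> tau \<nu> b"
      using bound[of a b] a by auto
    then show ?thesis
      using tau_attains[OF rd(2) t(1) _ b(1)] by metis
  qed
qed

text \<open>Along every selection of indices the value at y is t > 0, while \<open>delta0\<close>
  gives 0; weak convergence would force the two to agree.\<close>

lemma delta0_not_in_weak_closure_if_tau:
  assumes "\<And>k. real_distribution (M k)" "y > 0" "t > 0" "\<And>k. tau (M k) y = t"
  shows "\<not> delta0_in_weak_closure M"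
proof
  assume "delta0_in_weak_closure M"
  then obtain r where r: "weak_conv_m (\<lambda>j. M (r j)) delta0"
    by (auto simp: delta0_in_weak_closure_def)
  have "real_distribution delta0"
    unfolding delta0_def by (simp add: real_distribution_def real_distribution_axioms_def prob_space_return)
  then have "(\<lambda>j. tau (M (r j)) y) \<longlonglongrightarrow> tau delta0 y"
    using assms r by (intro tau_weak_conv) auto
  then show False
    using assms tau_delta0[of y] by (simp add: LIMSEQ_const_iff)
qed

theorem theorem6p2:
  fixes \<mu> :: "real measure" and \<mu>1 \<mu>2 :: "nat \<Rightarrow> real measure"
  assumes "prob_nonneg \<mu>" and "\<mu> \<noteq> delta0"
    and "\<And>k. prob_nonneg (\<mu>1 k)" and "\<And>k. prob_nonneg (\<mu>2 k)"
    and "\<And>k. \<mu> = boxtimes (\<mu>1 k) (\<mu>2 k)"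
  shows "\<exists>lam::nat \<Rightarrow> real. (\<forall>k. lam k > 0)
           \<and> tight (\<lambda>k. dil (lam k) (\<mu>1 k))
           \<and> tight (\<lambda>k. dil (inverse (lam k)) (\<mu>2 k))
           \<and> \<not> delta0_in_weak_closure (\<lambda>k. dil (lam k) (\<mu>1 k))
           \<and> \<not> delta0_in_weak_closure (\<lambda>k. dil (inverse (lam k)) (\<mu>2 k))"
proof -
  have rd: "real_distribution \<mu>" "real_distribution (\<mu>1 k)" "real_distribution (\<mu>2 k)" for k
    using assms by (auto intro: prob_nonnegD)
  \<comment> \<open>By its definition \<open>boxtimes\<close> yields \<open>delta0\<close> as soon
    as one factor is \<open>delta0\<close>.\<close>
  have nz: "\<mu>1 k \<noteq> delta0" "\<mu>2 k \<noteq> delta0" for k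
    using assms(2) assms(5)[of k] by (auto simp: boxtimes_def)
  have boxtimes_le: "tau \<mu> (x * y * ((1 - t) / t)) \<le> t"
    if "0 < t" "t < 1" "0 < x" "0 < y" "tau (\<mu>1 k) x \<le> t" "tau (\<mu>2 k) y \<le> t" for t x y k
    using tau_boxtimes(1)[OF assms(3) nz(1) assms(4) nz(2) that] by (simp only: assms(5)[symmetric])
  have boxtimes_ge: "t \<le> tau \<mu> (x * y * ((1 - t) / t))"
    if "0 < t" "t < 1" "0 < x" "0 < y" "t \<le> tau (\<mu>1 k) x" "t \<le> tau (\<mu>2 k) y" for t x y k
    using tau_boxtimes(2)[OF assms(3) nz(1) assms(4) nz(2) that] by (simp only: assms(5)[symmetric])
  \<comment> \<open>A level strictly below a value of \<open>tau \<mu>\<close>, so that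
    \<open>tau_factor_attains\<close> applies to every decomposition.\<close>
  define t0 where "t0 = tau \<mu> 1 / 2"
  have t0: "0 < t0" "t0 < tau \<mu> 1" "t0 < 1"
    using tau_pos[OF assms(1,2), of 1] tau_less_1[OF rd(1), of 1] by (auto simp: t0_def)
  have "\<exists>a>0. tau (\<mu>1 k) a = t0" "\<exists>b>0. tau (\<mu>2 k) b = t0" for k
    using tau_factor_attains[OF assms(3)[of k] nz(1)[of k] assms(4)[of k] nz(2)[of k], of 1 t0] t0
    by (simp_all only: assms(5)[symmetric] zero_less_one simp_thms)
  then obtain a b where a: "\<And>k. a k > 0" "\<And>k. tau (\<mu>1 k) (a k) = t0"
    and b: "\<And>k. b k > 0" "\<And>k. tau (\<mu>2 k) (b k) = t0"
    by metis
  obtain R where R: "R > 0" "tau \<mu> R = t0"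
    using tau_attains[OF rd(1) t0(1), of 1] t0 by auto
  define c where "c = R / ((1 - t0) / t0)"
  have c0: "c > 0" using R t0 by (simp add: c_def)
  \<comment> \<open>The product formula at level t0 makes \<open>tau \<mu>\<close> equal t0 at a
    multiple of \<open>a k * b k\<close>; strict monotonicity forces that point to be R, whatever k
    is.\<close>
  have c: "a k * b k = c" for k
  proof -
    have pos: "0 < a k * b k * ((1 - t0) / t0)"
      using a(1)[of k] b(1)[of k] t0 by simp
    have "tau \<mu> (a k * b k * ((1 - t0) / t0)) = tau \<mu> R"
      using boxtimes_le[OF t0(1,3) a(1)[of k] b(1)[of k], of k] boxtimes_ge[OF t0(1,3) a(1)[of k] b(1)[of k], of k] a(2) b(2) R(2)
      by (intro antisym) auto
    then have "a k * b k * ((1 - t0) / t0) = R"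
      using tau_strict_mono[OF assms(1,2), of R "a k * b k * ((1 - t0) / t0)"]
        tau_strict_mono[OF assms(1,2), of "a k * b k * ((1 - t0) / t0)" R] R(1) pos
      by (metis less_imp_le less_irrefl linorder_neqE_linordered_idom)
    then show ?thesis
      using t0 by (auto simp: c_def)
  qed
  \<comment> \<open>This dilation moves the point where the first factor takes the value t0 to 1;
    the opposite dilation moves that of the second factor to \<open>a k * b k\<close>, which is
    c.\<close>
  define lam where "lam k = 1 / a k" for k
  have lam: "lam k > 0" for k
    using a by (simp add: lam_def)
  have tau1: "tau (dil (lam k) (\<mu>1 k)) y = tau (\<mu>1 k) (y * a k)" if "y \<ge> 0" for k y
    using tau_dil[OF rd(2) lam that] by (simp add: lam_def)
  have tau2: "tau (dil (inverse (lam k)) (\<mu>2 k)) y = tau (\<mu>2 k) (y / a k)" if "y \<ge> 0" for k y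
    using tau_dil[OF rd(3) a(1) that] by (simp add: lam_def)
  have small: "\<exists>y>0. (\<forall>k. tau (dil (lam k) (\<mu>1 k)) y < \<epsilon>) \<and> (\<forall>k. tau (dil (inverse (lam k)) (\<mu>2 k)) (c * y) < \<epsilon>)"
    if "\<epsilon> > 0" for \<epsilon>
  proof -
    \<comment> \<open>As t \<le> t0, the other factor is at least t at \<open>b k\<close> or at
      \<open>a k\<close>. If the first factor were at least t at \<open>y * a k\<close>, or the
      second at \<open>c * y / a k\<close>, then \<open>boxtimes_ge\<close> would give
      \<open>tau \<mu> z\<close> \<ge> t. The choice of y makes both products land at the same z,
      which does not depend on k.\<close>
    define t where "t = min (\<epsilon> / 2) (t0 / 2)"
    have t: "0 < t" "t < \<epsilon>" "t \<le> t0" "t < 1"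
      using that t0 by (auto simp: t_def)
    obtain z where z: "z > 0" "tau \<mu> z < t"
      using tau_small[OF rd(1) t(1)] .
    define y where "y = z / (c * ((1 - t) / t))"
    have y: "y > 0" "y * c * ((1 - t) / t) = z"
      using z t c0 by (auto simp: y_def)
    have "tau (\<mu>1 k) (y * a k) < t" for k
    proof (rule ccontr)
      assume "\<not> ?thesis"
      then have "t \<le> tau \<mu> (y * a k * b k * ((1 - t) / t))"
        using a b y t by (intro boxtimes_ge[of t _ _ k]) auto
      also have "y * a k * b k * ((1 - t) / t) = z"
        using y(2) c[of k] by (simp only: mult.assoc)
      finally show False using z by simp
    qed
    moreover have "tau (\<mu>2 k) (c * y / a k) < t" for k
    proof (rule ccontr)
      assume "\<not> ?thesis"
      then have "t \<le> tau \<mu> (a k * (c * y / a k) * ((1 - t) / t))"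
        using a y t c0 by (intro boxtimes_ge[of t _ _ k]) auto
      also have "a k * (c * y / a k) * ((1 - t) / t) = z"
        using y(2) a(1)[of k] by (simp add: mult_ac)
      finally show False using z by simp
    qed
    ultimately show ?thesis
      using y c0 t(2) less_trans by (intro exI[of _ y]) (fastforce simp: tau1 tau2)
  qed
  have pn: "prob_nonneg (dil (lam k) (\<mu>1 k))" "prob_nonneg (dil (inverse (lam k)) (\<mu>2 k))" for k
    using lam[of k] assms(3,4) by (auto intro!: prob_nonneg_dil)
  have "tight (\<lambda>k. dil (lam k) (\<mu>1 k))"
    using small by (intro tight_if_tau pn) (meson always_eventually)
  moreover have "tight (\<lambda>k. dil (inverse (lam k)) (\<mu>2 k))"
  proof (rule tight_if_tau[OF pn(2)])
    fix \<epsilon> :: real assume "\<epsilon> > 0"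
    then obtain y where "y > 0" "\<forall>k. tau (dil (inverse (lam k)) (\<mu>2 k)) (c * y) < \<epsilon>"
      using small by blast
    then show "\<exists>y>0. \<forall>\<^sub>F k in sequentially. tau (dil (inverse (lam k)) (\<mu>2 k)) y < \<epsilon>"
      using c0 by (intro exI[of _ "c * y"]) auto
  qed
  moreover have "\<not> delta0_in_weak_closure (\<lambda>k. dil (lam k) (\<mu>1 k))"
    by (rule delta0_not_in_weak_closure_if_tau[of _ 1 t0])
       (use t0 a in \<open>auto simp: tau1 intro: prob_nonnegD pn\<close>)
  moreover have "\<not> delta0_in_weak_closure (\<lambda>k. dil (inverse (lam k)) (\<mu>2 k))"
  proof (rule delta0_not_in_weak_closure_if_tau[of _ c t0])
    fix k
    have "c / a k = b k"
      using c[of k] a(1)[of k] by (simp add: field_simps)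
    then show "tau (dil (inverse (lam k)) (\<mu>2 k)) c = t0"
      using b c0 by (simp add: tau2)
  qed (use t0 c0 in \<open>auto intro: prob_nonnegD pn\<close>)
  ultimately show ?thesis
    using lam by blast
qed

end
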